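(* Let $(e_i)$ be a semi-normalized basic sequence in a Banach space. Suppose that every subsequence $(f_i)$ of $(e_i)$ has the following property: there exists $K>0$ (possibly depending on the subsequence) such that for all $\alpha,\beta\in\operatorname{span}((f_i))$, $$\frac1K\|\alpha\|\,\|\beta\|\le\|\alpha\otimes\beta\|\le K\|\alpha\|\,\|\beta\|,$$ where $\otimes$ is the multiplication associated with $(f_i)$. Then $(e_i)$ is equivalent to the unit vector basis of $c_0$ or of $\ell_p$ for some $1\le p<\infty$.
   Context: A sequence $(e_i)$ is semi-normalized if $0<\inf_i\|e_i\|\le\sup_i\|e_i\|<\infty$. $\operatorname{span}$ denotes the set of finite linear combinations. For any semi-normalized basic sequence $(f_i)$, the multiplication $\otimes$ associated with $(f_i)$ on $\operatorname{span}((f_i))$ is defined as follows: for $\alpha=\sum_{i=1}^n a_if_i$ and $\beta=\sum_{j=1}^m b_jf_j$ with $b_m\ne0$, $$\alpha\otimes\beta=\sum_{i=1}^n a_i\Big(\sum_{j=1}^m b_j f_{(i-1)m+j}\Big),$$ and $\alpha\otimes 0=0$. The multiplication depends on the basic sequence: for a subsequence $(f_i)$ of $(e_i)$ it is computed with the indexing of $(f_i)$, not that of $(e_i)$. Two basic sequences $(x_i)$, $(y_i)$ are equivalent if there is $C>0$ with $\frac1C\|\sum a_ix_i\|\le\|\sum a_iy_i\|\le C\|\sum a_ix_i\|$ for all finitely supported scalar sequences $(a_i)$. *)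

theory Defs
  imports "HOL-Analysis.Analysis" "HOL-Library.Function_Algebras"
begin

text \<open>
  To cover real and complex Banach spaces at once, the scalar field is a type of sort
  \<open>{real_normed_field, euclidean_space}\<close> (up to isometric isomorphism these are exactly the real
  and the complex numbers) and scalar multiplication is an explicit parameter \<open>scl\<close>.

  Sequences are indexed from 0, so that the mathematical \<open>e\<^sub>i\<close> is \<open>e (i - 1)\<close>.
\<close>

definition semi_normalized :: "(nat \<Rightarrow> 'a::real_normed_vector) \<Rightarrow> bool" where
  "semi_normalized e \<longleftrightarrow>
     0 < (INF i. norm (e i)) \<and> bdd_above (range (\<lambda>i. norm (e i)))"

text \<open>A basic sequence is a Schauder basis of its closed linear span.\<close>

definition basic_sequence ::
  "('k::real_normed_field \<Rightarrow> 'a::real_normed_vector \<Rightarrow> 'a) \<Rightarrow> (nat \<Rightarrow> 'a) \<Rightarrow> bool" where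
  "basic_sequence scl e \<longleftrightarrow>
     (\<forall>x \<in> closure (module.span scl (range e)).
        \<exists>!a. (\<lambda>i. scl (a i) (e i)) sums x)"

text \<open>
  \<open>coord scl f x i\<close> is the coefficient of \<open>f i\<close> in the finite expansion of
  \<open>x \<in> span (range f)\<close>, for an injective, linearly independent family \<open>f\<close>;
  \<open>len scl f x\<close> is the (1-based) position of the last nonzero coefficient,
  and 0 for \<open>x = 0\<close>.
\<close>

definition coord ::
  "('k::field \<Rightarrow> 'a::ab_group_add \<Rightarrow> 'a) \<Rightarrow> (nat \<Rightarrow> 'a) \<Rightarrow> 'a \<Rightarrow> nat \<Rightarrow> 'k" where
  "coord scl f x i = module.representation scl (range f) x (f i)"

definition len ::
  "('k::field \<Rightarrow> 'a::ab_group_add \<Rightarrow> 'a) \<Rightarrow> (nat \<Rightarrow> 'a) \<Rightarrow> 'a \<Rightarrow> nat" where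
  "len scl f x = (LEAST m. \<forall>i\<ge>m. coord scl f x i = 0)"

text \<open>
  The 1-based index \<open>(i - 1) m + j\<close> becomes \<open>i m + j\<close> in 0-based indexing.
  If \<open>\<beta> = 0\<close>, the inner sum is empty and the product is 0.
\<close>

definition seq_mult ::
  "('k::field \<Rightarrow> 'a::ab_group_add \<Rightarrow> 'a) \<Rightarrow> (nat \<Rightarrow> 'a) \<Rightarrow> 'a \<Rightarrow> 'a \<Rightarrow> 'a" where
  "seq_mult scl f \<alpha> \<beta> =
     (\<Sum>i<len scl f \<alpha>. scl (coord scl f \<alpha> i)
        (\<Sum>j<len scl f \<beta>. scl (coord scl f \<beta> j) (f (i * len scl f \<beta> + j))))"

text \<open>
  The norms are explicit arguments because \<open>c\<^sub>0\<close> and \<open>\<ell>\<^sub>p\<close> are not types: their norms live on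
  the space \<open>nat \<Rightarrow> 'k\<close> of all scalar sequences, with pointwise operations.
\<close>

definition equivalent_seqs ::
  "('k::zero \<Rightarrow> 'a::comm_monoid_add \<Rightarrow> 'a) \<Rightarrow> ('a \<Rightarrow> real) \<Rightarrow> (nat \<Rightarrow> 'a) \<Rightarrow>
   ('k \<Rightarrow> 'b::comm_monoid_add \<Rightarrow> 'b) \<Rightarrow> ('b \<Rightarrow> real) \<Rightarrow> (nat \<Rightarrow> 'b) \<Rightarrow> bool" where
  "equivalent_seqs scale1 norm1 x scale2 norm2 y \<longleftrightarrow>
     (\<exists>C>0. \<forall>a. finite {i. a i \<noteq> 0} \<longrightarrow>
        1 / C * norm1 (\<Sum>i | a i \<noteq> 0. scale1 (a i) (x i))
          \<le> norm2 (\<Sum>i | a i \<noteq> 0. scale2 (a i) (y i)) \<and>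
        norm2 (\<Sum>i | a i \<noteq> 0. scale2 (a i) (y i))
          \<le> C * norm1 (\<Sum>i | a i \<noteq> 0. scale1 (a i) (x i)))"

definition seq_scale :: "'k::times \<Rightarrow> (nat \<Rightarrow> 'k) \<Rightarrow> nat \<Rightarrow> 'k" where
  "seq_scale c x = (\<lambda>i. c * x i)"

definition unit_vec :: "nat \<Rightarrow> nat \<Rightarrow> 'k::zero_neq_one" where
  "unit_vec i = (\<lambda>k. if k = i then 1 else 0)"

text \<open>
  The next two are meaningful only on \<open>c\<^sub>0\<close> (bounded sequences, more generally) and on
  \<open>\<ell>\<^sub>p\<close> respectively; these contain all finitely supported sequences.
\<close>

definition c0_norm :: "(nat \<Rightarrow> 'k::real_normed_vector) \<Rightarrow> real" where
  "c0_norm x = (SUP i. norm (x i))"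

definition lp_norm :: "real \<Rightarrow> (nat \<Rightarrow> 'k::real_normed_vector) \<Rightarrow> real" where
  "lp_norm p x = (\<Sum>i. norm (x i) powr p) powr (1 / p)"


subsection \<open>Sanity checks\<close>

lemma sum_unit_vec:
  fixes a :: "nat \<Rightarrow> 'k::field"
  assumes "finite {i. a i \<noteq> 0}"
  shows "(\<Sum>i | a i \<noteq> 0. seq_scale (a i) (unit_vec i)) = a"
proof
  fix k
  have *: "(\<Sum>i\<in>A. g i) k = (\<Sum>i\<in>A. g i k)" if "finite A"
    for A and g :: "nat \<Rightarrow> nat \<Rightarrow> 'k"
    using that by induction auto
  have "(\<Sum>i | a i \<noteq> 0. seq_scale (a i) (unit_vec i)) k =
        (\<Sum>i | a i \<noteq> 0. if k = i then a i else 0)"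
    unfolding *[OF assms] by (intro sum.cong) (auto simp: seq_scale_def unit_vec_def)
  also have "\<dots> = a k" using assms by auto
  finally show "(\<Sum>i | a i \<noteq> 0. seq_scale (a i) (unit_vec i)) k = a k" .
qed

lemma basic_sequence_independent:
  assumes vs: "vector_space scl" and e: "basic_sequence scl e"
  shows "inj e" and "\<not> module.dependent scl (range e)"
proof -
  interpret vector_space scl by (fact vs)
  have zero: "a = (\<lambda>_. 0)" if "(\<lambda>i. scl (a i) (e i)) sums 0" for a
  proof -
    have "0 \<in> closure (span (range e))"
      by (rule subsetD[OF closure_subset span_zero])
    then have ex1: "\<exists>!a. (\<lambda>i. scl (a i) (e i)) sums 0"
      using e unfolding basic_sequence_def by (rule bspec[rotated])
    have "(\<lambda>i. scl ((\<lambda>_. 0) i) (e i)) sums 0" by simp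
    then show ?thesis using the1_equality[OF ex1, of a] the1_equality[OF ex1, of "\<lambda>_. 0"] that by simp
  qed
  show inj: "inj e"
  proof (rule injI, rule ccontr)
    fix i j assume ij: "e i = e j" "i \<noteq> j"
    define a where "a = (\<lambda>k. if k = i then 1 else if k = j then - 1 else (0::'a))"
    have "(\<lambda>k. scl (a k) (e k)) sums (\<Sum>k\<in>{i,j}. scl (a k) (e k))"
      by (rule sums_finite) (auto simp: a_def)
    also have "(\<Sum>k\<in>{i,j}. scl (a k) (e k)) = 0"
      using ij by (simp add: a_def)
    finally have "a i = 0" using zero by metis
    then show False by (simp add: a_def)
  qed
  show "independent (range e)"
  proof
    assume "dependent (range e)"
    then obtain t u v where t: "finite t" "t \<subseteq> range e" "(\<Sum>v\<in>t. scl (u v) v) = 0"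
      and v: "v \<in> t" "u v \<noteq> 0"
      unfolding dependent_explicit by auto
    define a where "a = (\<lambda>k. if e k \<in> t then u (e k) else 0)"
    have fin: "finite (e -` t)" by (rule finite_vimageI[OF t(1) inj])
    have "(\<lambda>k. scl (a k) (e k)) sums (\<Sum>k\<in>e -` t. scl (a k) (e k))"
      by (rule sums_finite[OF fin]) (auto simp: a_def)
    also have "(\<Sum>k\<in>e -` t. scl (a k) (e k)) = (\<Sum>v\<in>e ` (e -` t). scl (u v) v)"
      by (subst sum.reindex) (auto simp: a_def intro: inj_on_subset[OF inj])
    also have "e ` (e -` t) = t" using t(2) by auto
    finally have "a = (\<lambda>_. 0)" using t(3) zero by simp
    moreover obtain k where "v = e k" using v t(2) by auto
    ultimately show False using v by (auto simp: a_def dest: fun_cong[of _ _ k])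
  qed
qed

lemma coord_sum:
  assumes vs: "vector_space scl" and inj: "inj f"
    and ind: "\<not> module.dependent scl (range f)"
  shows "coord scl f (\<Sum>i<n. scl (a i) (f i)) k = (if k < n then a k else 0)"
proof -
  interpret vector_space scl by (fact vs)
  have in_span: "f i \<in> span (range f)" for i by (simp add: span_base)
  have 1: "representation (range f) (f i) (f k) = (if i = k then 1 else 0)" for i
    using representation_basis[OF ind, of "f i"] inj by (auto simp: inj_eq)
  have "coord scl f (\<Sum>i<n. scl (a i) (f i)) k =
        (\<Sum>i<n. a i * (if i = k then 1 else 0))"
    unfolding coord_def
    by (subst representation_sum[OF ind])
       (auto simp: representation_scale[OF ind] in_span span_scale 1 intro!: sum.cong)
  also have "\<dots> = (if k < n then a k else 0)"
    by (simp add: if_distrib cong: if_cong)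
  finally show ?thesis .
qed

lemma seq_mult_expansion:
  assumes vs: "vector_space scl" and inj: "inj f"
    and ind: "\<not> module.dependent scl (range f)"
    and m: "m > 0" "b (m - 1) \<noteq> 0"
  shows "seq_mult scl f (\<Sum>i<n. scl (a i) (f i)) (\<Sum>j<m. scl (b j) (f j)) =
         (\<Sum>i<n. scl (a i) (\<Sum>j<m. scl (b j) (f (i * m + j))))"
proof -
  interpret vector_space scl by (fact vs)
  note c = coord_sum[OF vs inj ind]
  define \<alpha> where "\<alpha> = (\<Sum>i<n. scl (a i) (f i))"
  have len_m: "len scl f (\<Sum>j<m. scl (b j) (f j)) = m"
    unfolding len_def c
  proof (rule Least_equality)
    fix l assume l: "\<forall>i\<ge>l. (if i < m then b i else 0) = 0"
    show "m \<le> l"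
    proof (rule ccontr)
      assume "\<not> m \<le> l"
      then have "b (m - 1) = 0" using l[rule_format, of "m - 1"] m(1) by simp
      with m(2) show False by simp
    qed
  qed auto
  have ca: "coord scl f \<alpha> i = (if i < n then a i else 0)" for i
    unfolding \<alpha>_def by (rule c)
  have ex: "\<forall>i\<ge>n. coord scl f \<alpha> i = 0" by (simp add: ca)
  have le: "len scl f \<alpha> \<le> n" unfolding len_def by (rule Least_le) (fact ex)
  have z: "coord scl f \<alpha> i = 0" if "i \<ge> len scl f \<alpha>" for i
    using LeastI[of "\<lambda>m. \<forall>i\<ge>m. coord scl f \<alpha> i = 0", OF ex] that
    unfolding len_def by blast
  have "seq_mult scl f \<alpha> (\<Sum>j<m. scl (b j) (f j)) =
    (\<Sum>i<len scl f \<alpha>. scl (coord scl f \<alpha> i) (\<Sum>j<m. scl (b j) (f (i * m + j))))"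
    unfolding seq_mult_def len_m by (simp add: c)
  also have "\<dots> = (\<Sum>i<n. scl (coord scl f \<alpha> i) (\<Sum>j<m. scl (b j) (f (i * m + j))))"
    using le z by (intro sum.mono_neutral_left) auto
  also have "\<dots> = (\<Sum>i<n. scl (a i) (\<Sum>j<m. scl (b j) (f (i * m + j))))"
    by (intro sum.cong) (auto simp: ca)
  finally show ?thesis unfolding \<alpha>_def .
qed

end

theory Submission
  imports Defs
begin

text \<open>
  Letting the last coefficient of the second factor tend to 0, the inequalities extend to factors
  padded with zeros; with a unit vector as second factor they say that all arithmetic progressions
  in a subsequence \<open>f\<close> are uniformly equivalent to \<open>f\<close>. Any countable family of finite
  subsequences of \<open>e\<close> can be placed, up to dilation, as progressions into one subsequence, so all
  subsequences of \<open>e\<close> are uniformly equivalent to \<open>e\<close>. Since \<open>e\<close> is also equivalent to the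
  differences \<open>e (2 * i) - e (2 * i + 1)\<close>, it is unconditional. The norms \<open>\<phi> n\<close> of
  \<open>e 0 + \<dots> + e (n - 1)\<close> are almost multiplicative, hence comparable to \<open>n powr \<theta>\<close>. This determines
  the norm on indicator sequences, and by a dyadic decomposition on all sequences up to a logarithmic
  factor, which is removed by passing to tensor powers. The space is \<open>c\<^sub>0\<close> if \<open>\<theta> = 0\<close> and
  \<open>\<ell>\<^sub>p\<close> with \<open>p = 1 / \<theta>\<close> otherwise.
\<close>

section \<open>Two-sided estimates and tensor products of coefficient sequences\<close>

definition comparable :: "real \<Rightarrow> real \<Rightarrow> real \<Rightarrow> bool" where
  "comparable C x y \<longleftrightarrow> x \<le> C * y \<and> y \<le> C * x"

lemma comparable_sym: "comparable C x y \<Longrightarrow> comparable C y x"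
  by (auto simp: comparable_def)

lemma comparable_trans:
  assumes "comparable C x y" "comparable D y z" "0 \<le> C" "0 \<le> D"
  shows "comparable (C * D) x z"
proof -
  have "x \<le> C * (D * z)"
    using assms by (meson comparable_def mult_left_mono order_trans)
  moreover have "z \<le> D * (C * x)"
    using assms by (meson comparable_def mult_left_mono order_trans)
  ultimately show ?thesis by (simp add: comparable_def mult_ac)
qed

lemma comparable_mono:
  assumes "comparable C x y" "C \<le> D" "0 \<le> x" "0 \<le> y"
  shows "comparable D x y"
  using assms by (meson comparable_def mult_right_mono order_trans)

text \<open>If \<open>b (m - 1) \<noteq> 0\<close>, the first \<open>n * m\<close> entries are the
  coefficients of the product of \<open>n\<close> coefficients \<open>a\<close> with
  \<open>m\<close> coefficients \<open>b\<close>. The block length \<open>m\<close> is explicit, so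
  trailing zeros of \<open>b\<close> are allowed.\<close>

definition tensor :: "nat \<Rightarrow> (nat \<Rightarrow> 'k::times) \<Rightarrow> (nat \<Rightarrow> 'k) \<Rightarrow> nat \<Rightarrow> 'k" where
  "tensor m a b k = a (k div m) * b (k mod m)"

lemma sum_div_mod:
  fixes g :: "nat \<Rightarrow> 'b::comm_monoid_add"
  shows "(\<Sum>k<n * m. g k) = (\<Sum>i<n. \<Sum>j<m. g (i * m + j))"
proof -
  have "sum g {i * m..<i * m + m} = (\<Sum>j<m. g (i * m + j))" for i
    using sum.shift_bounds_nat_ivl[of g 0 "i * m" m]
    by (simp add: atLeast0LessThan add.commute)
  then show ?thesis by (simp flip: sum.nat_group)
qed

subsection \<open>Gluing progressions into one sequence\<close>

lemma strict_mono_ident: "strict_mono (\<lambda>x::nat. x)"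
  by (simp add: strict_mono_def)

text \<open>Beyond \<open>p\<close> the values form blocks of \<open>m\<close> consecutive integers,
  block \<open>i\<close> starting at \<open>m * l i + h p\<close>, so the progression with
  difference \<open>m\<close> from \<open>p\<close> is a dilated and shifted copy of
  \<open>l\<close>. The choice of \<open>m\<close> keeps both offsets, \<open>p\<close> and
  \<open>h p\<close>, below \<open>m\<close>.\<close>

lemma strict_mono_extension:
  fixes h l :: "nat \<Rightarrow> nat"
  assumes h: "strict_mono h" and l: "strict_mono l" and m: "m = Suc (h p)"
  shows "strict_mono (\<lambda>x. if x < p then h x else m * l ((x - p) div m) + h p + (x - p) mod m)"
    (is "strict_mono ?g")
proof (rule strict_mono_Suc_iff[THEN iffD2], rule allI)
  fix x
  consider "Suc x < p" | "Suc x = p" | "p \<le> x" by linarith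
  then show "?g x < ?g (Suc x)"
  proof cases
    case 1
    then show ?thesis using h by (simp add: strict_mono_Suc_iff)
  next
    case 2
    then have "h x < h p" using h by (auto simp: strict_mono_Suc_iff)
    then show ?thesis using 2 by (simp add: trans_less_add1)
  next
    case 3
    define t where "t = x - p"
    have t: "Suc x - p = Suc t" using 3 by (simp add: t_def)
    have "m * l (t div m) + t mod m < m * l (Suc t div m) + Suc t mod m"
    proof (cases "Suc (t mod m) = m")
      case True
      have "m * Suc (l (t div m)) \<le> m * l (Suc (t div m))"
        using l by (intro mult_le_mono2) (simp add: strict_mono_Suc_iff Suc_leI)
      moreover have "t mod m < m" using m by simp
      ultimately show ?thesis using True by (simp add: div_Suc mod_Suc)
    next
      case False
      then show ?thesis by (simp add: div_Suc mod_Suc)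
    qed
    then show ?thesis using 3 t by (simp flip: t_def)
  qed
qed

text \<open>Stage \<open>k\<close> keeps a prefix of the sequence built so far and continues it by
  \<open>strict_mono_extension\<close> with \<open>l k\<close>. The bounds \<open>p < m\<close> and
  \<open>q < m\<close> are those required of offsets in
  \<open>progression_comparable\<close>.\<close>

lemma glue_progressions:
  fixes l :: "nat \<Rightarrow> nat \<Rightarrow> nat" and n :: "nat \<Rightarrow> nat"
  assumes l: "\<And>k. strict_mono (l k)"
  obtains h where "strict_mono h"
    and "\<And>k. \<exists>m p q. p < m \<and> q < m \<and> (\<forall>i<n k. h (i * m + p) = m * l k i + q)"
proof -
  define ext where "ext k h p = (\<lambda>x. if x < p then h x else
      Suc (h p) * l k ((x - p) div Suc (h p)) + h p + (x - p) mod Suc (h p))"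
    for k p and h :: "nat \<Rightarrow> nat"
  \<comment> \<open>A state is the current sequence together with the length of its frozen prefix.
    Stage \<open>k\<close> freezes enough for \<open>n k\<close> terms of its progression; the extra
    1 makes the prefixes exhaust all indices.\<close>
  define S where "S = rec_nat (\<lambda>x. x, 0)
    (\<lambda>k (h, p). (ext k h p, p + n k * Suc (h p) + 1))"
  define H where "H k = fst (S k)" for k
  define P where "P k = snd (S k)" for k
  have H_Suc: "H (Suc k) = ext k (H k) (P k)"
    and P_Suc: "P (Suc k) = P k + n k * Suc (H k (P k)) + 1" for k
    by (simp_all add: H_def P_def S_def split: prod.splits)
  have mono_H: "strict_mono (H k)" for k
  proof (induction k)
    case 0
    then show ?case by (simp add: H_def S_def strict_mono_def)
  next
    case (Suc k)
    show ?case unfolding H_Suc ext_def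
      by (rule strict_mono_extension[OF Suc l refl])
  qed
  have P_ge: "k \<le> P k" for k
    by (induction k) (auto simp: P_Suc)
  have P_mono: "P k \<le> P k'" if "k \<le> k'" for k k'
    using that by (rule lift_Suc_mono_le[rotated]) (simp add: P_Suc)
  have stable: "H k' x = H k x" if "k \<le> k'" "x < P k" for k k' x
    using that(1)
  proof (induction rule: dec_induct)
    case (step i)
    then have "x < P i" using P_mono[of k i] that by linarith
    then show ?case using step by (simp add: H_Suc ext_def)
  qed simp
  \<comment> \<open>The limit sequence: by \<open>P_ge\<close> the value at \<open>x\<close> is
    frozen from stage \<open>Suc x\<close> on.\<close>
  define h where "h x = H (Suc x) x" for x
  have h_eq: "h x = H k x" if "x < P k" for x k
  proof -
    have "x < P (Suc x)" using P_ge[of "Suc x"] by simp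
    then show ?thesis unfolding h_def
      using stable[of k "Suc x" x] stable[of "Suc x" k x] that by (metis nat_le_linear)
  qed
  have "strict_mono h"
  proof (rule strict_monoI)
    fix x y :: nat assume "x < y"
    moreover have "y < P (Suc y)" using P_ge[of "Suc y"] by simp
    ultimately show "h x < h y"
      using h_eq[of x "Suc y"] h_eq[of y "Suc y"] mono_H[of "Suc y"]
      by (simp add: strict_monoD)
  qed
  moreover have "\<exists>m p q. p < m \<and> q < m \<and> (\<forall>i<n k. h (i * m + p) = m * l k i + q)" for k
  proof -
    define m where "m = Suc (H k (P k))"
    have "P k < m"
      using strict_mono_imp_increasing[OF mono_H[of k], of "P k"] by (simp add: m_def)
    moreover have "h (i * m + P k) = m * l k i + H k (P k)" if "i < n k" for i
    proof -
      have "i * m \<le> n k * m" using that by (intro mult_le_mono1) simp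
      moreover have "P (Suc k) = P k + n k * m + 1" by (simp add: P_Suc m_def)
      ultimately have "i * m + P k < P (Suc k)" by linarith
      then have "h (i * m + P k) = H (Suc k) (i * m + P k)" by (rule h_eq)
      also have "\<dots> = m * l k i + H k (P k)"
        by (simp add: H_Suc ext_def flip: m_def)
      finally show ?thesis .
    qed
    ultimately show ?thesis unfolding m_def by blast
  qed
  ultimately show ?thesis by (rule that)
qed

subsection \<open>Norms of coefficient sequences\<close>

locale scaled_norm = vector_space scl
  for scl :: "'k::{real_normed_field, euclidean_space} \<Rightarrow> 'a::real_normed_vector \<Rightarrow> 'a" +
  assumes norm_scl: "norm (scl c x) = norm c * norm x"
begin

definition nrm :: "(nat \<Rightarrow> 'a) \<Rightarrow> nat \<Rightarrow> (nat \<Rightarrow> 'k) \<Rightarrow> real" where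
  "nrm f n a = norm (\<Sum>i<n. scl (a i) (f i))"

lemma nrm_nonneg [simp]: "0 \<le> nrm f n a"
  by (simp add: nrm_def)

lemma nrm_cong: "(\<And>i. i < n \<Longrightarrow> a i = b i) \<Longrightarrow> (\<And>i. i < n \<Longrightarrow> f i = g i) \<Longrightarrow> nrm f n a = nrm g n b"
  by (simp add: nrm_def)

lemma nrm_add_le: "nrm f n (\<lambda>i. a i + b i) \<le> nrm f n a + nrm f n b"
  by (simp add: nrm_def scale_left_distrib sum.distrib norm_triangle_ineq)

lemma nrm_scale: "nrm f n (\<lambda>i. c * a i) = norm c * nrm f n a"
  by (simp add: nrm_def flip: norm_scl) (simp add: scale_sum_right)

lemma nrm_sum_le: "nrm f n (\<lambda>i. \<Sum>b\<in>B. g b i) \<le> (\<Sum>b\<in>B. nrm f n (g b))"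
proof -
  have "(\<Sum>i<n. scl (\<Sum>b\<in>B. g b i) (f i)) = (\<Sum>b\<in>B. \<Sum>i<n. scl (g b i) (f i))"
    by (simp add: scale_sum_left sum.swap[of _ B])
  then show ?thesis by (simp add: nrm_def norm_sum)
qed

lemma nrm_tensor:
  "nrm f (n * m) (tensor m a b) = norm (\<Sum>i<n. scl (a i) (\<Sum>j<m. scl (b j) (f (i * m + j))))"
  unfolding nrm_def sum_div_mod
  by (intro arg_cong[where f = norm] sum.cong refl) (simp add: tensor_def scale_sum_right)

lemma nrm_unit: "j < m \<Longrightarrow> nrm f m (\<lambda>k. if k = j then 1 else 0) = norm (f j)"
  by (simp add: nrm_def if_distrib[where f = "\<lambda>c. scl c _"] cong: if_cong)

lemma nrm_tensor_unit:
  assumes "j < m"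
  shows "nrm f (n * m) (tensor m a (\<lambda>k. if k = j then 1 else 0)) = nrm (\<lambda>i. f (i * m + j)) n a"
  unfolding nrm_tensor using assms
  by (simp add: nrm_def if_distrib[where f = "\<lambda>c. scl c _"] cong: if_cong)

text \<open>The coefficients are padded with zeros in the gaps of \<open>l\<close>. The same
  \<open>a'\<close> serves every \<open>g\<close>, so an estimate between two sequences for all
  coefficients passes to their subsequences along \<open>l\<close>.\<close>

lemma nrm_reindex:
  assumes l: "strict_mono l"
  obtains a' where "\<And>g. nrm g (l n) a' = nrm (\<lambda>i. g (l i)) n a"
proof -
  define a' where "a' t = (if t \<in> l ` {..<n} then a (the_inv l t) else 0)" for t
  have inj: "inj l" using l by (rule strict_mono_imp_inj_on)
  have "(\<Sum>t<l n. scl (a' t) (g t)) = (\<Sum>i<n. scl (a i) (g (l i)))" for g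
  proof -
    have "(\<Sum>t<l n. scl (a' t) (g t)) = (\<Sum>t\<in>l ` {..<n}. scl (a' t) (g t))"
      by (rule sum.mono_neutral_right) (auto simp: a'_def strict_monoD[OF l])
    also have "\<dots> = (\<Sum>i<n. scl (a' (l i)) (g (l i)))"
      by (subst sum.reindex) (auto intro: inj_on_subset[OF inj])
    also have "\<dots> = (\<Sum>i<n. scl (a i) (g (l i)))"
      by (intro sum.cong) (auto simp: a'_def the_inv_f_f[OF inj])
    finally show ?thesis .
  qed
  then show ?thesis by (intro that[of a']) (simp add: nrm_def)
qed

text \<open>Since \<open>scl\<close> is a parameter, its continuity is derived from
  \<open>norm_scl\<close>.\<close>

lemma tendsto_nrm:
  assumes "\<And>i. i < n \<Longrightarrow> (\<lambda>k. a k i) \<longlonglongrightarrow> b i"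
  shows "(\<lambda>k. nrm f n (a k)) \<longlonglongrightarrow> nrm f n b"
proof -
  have "(\<lambda>k. scl (a k i) (f i)) \<longlonglongrightarrow> scl (b i) (f i)" if "i < n" for i
  proof (rule Lim_transform_bound[THEN LIM_zero_cancel])
    show "\<forall>\<^sub>F k in sequentially. norm (scl (a k i) (f i) - scl (b i) (f i))
        \<le> norm (norm (a k i - b i) * norm (f i))"
      by (simp add: norm_scl flip: scale_left_diff_distrib)
    have "(\<lambda>k. norm (a k i - b i) * norm (f i)) \<longlonglongrightarrow> norm (b i - b i) * norm (f i)"
      by (intro tendsto_intros assms that)
    then show "(\<lambda>k. norm (a k i - b i) * norm (f i)) \<longlonglongrightarrow> 0" by simp
  qed
  then show ?thesis unfolding nrm_def by (intro tendsto_norm tendsto_sum) auto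
qed

lemma nrm_le_sum: "nrm f n a \<le> (\<Sum>i<n. norm (a i) * norm (f i))"
  unfolding nrm_def by (rule order_trans[OF norm_sum]) (simp add: norm_scl)

end

subsection \<open>Spreading and unconditionality\<close>

text \<open>The hypotheses of the theorem in terms of coefficients, with zero padding allowed in the
  second factor. \<open>K\<close> may depend on \<open>r\<close>; uniformity over subsequences comes
  with \<open>spreading\<close>. By \<open>distinct\<close>, \<open>e 0 - e 1\<close> is a nonzero
  factor.\<close>

locale tensor_seq = scaled_norm scl
  for scl :: "'k::{real_normed_field, euclidean_space} \<Rightarrow> 'a::real_normed_vector \<Rightarrow> 'a" +
  fixes e :: "nat \<Rightarrow> 'a"
  assumes distinct: "e 0 \<noteq> e 1"
    and norm_lower: "\<exists>c>0. \<forall>i. c \<le> norm (e i)"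
    and norm_upper: "\<exists>B. \<forall>i. norm (e i) \<le> B"
    and tensor_comparable: "strict_mono r \<Longrightarrow>
      \<exists>K\<ge>1. \<forall>n m a b. 0 < m \<longrightarrow>
        comparable K (nrm (\<lambda>i. e (r i)) (n * m) (tensor m a b))
          (nrm (\<lambda>i. e (r i)) n a * nrm (\<lambda>i. e (r i)) m b)"
begin

text \<open>The second factor is the unit vector at \<open>j\<close>, padded to length
  \<open>m\<close>. Its norm \<open>norm (e (r j))\<close> lies between the positive constants
  \<open>c\<close> and \<open>B\<close> and is absorbed into \<open>D\<close>.\<close>

lemma progression_comparable:
  assumes "strict_mono r"
  shows "\<exists>C\<ge>1. \<forall>n m j a. j < m \<longrightarrow>
    comparable C (nrm (\<lambda>i. e (r (i * m + j))) n a) (nrm (\<lambda>i. e (r i)) n a)"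
proof -
  obtain K where K: "K \<ge> 1" "\<And>n m a b. 0 < m \<Longrightarrow>
      comparable K (nrm (\<lambda>i. e (r i)) (n * m) (tensor m a b))
        (nrm (\<lambda>i. e (r i)) n a * nrm (\<lambda>i. e (r i)) m b)"
    using tensor_comparable[OF assms] by blast
  obtain c where c: "c > 0" "\<And>i. c \<le> norm (e i)" using norm_lower by blast
  obtain B where B: "\<And>i. norm (e i) \<le> B" using norm_upper by blast
  have cB: "c \<le> B" using c(2)[of 0] B[of 0] by linarith
  define D where "D = max 1 (max B (1 / c))"
  have D: "1 \<le> D" "B \<le> D" "1 / c \<le> D" by (simp_all add: D_def)
  have "comparable (K * D) (nrm (\<lambda>i. e (r (i * m + j))) n a) (nrm (\<lambda>i. e (r i)) n a)"
    if "j < m" for n m j a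
  proof (rule comparable_trans)
    let ?N = "nrm (\<lambda>i. e (r i)) n a"
    show "comparable K (nrm (\<lambda>i. e (r (i * m + j))) n a) (?N * norm (e (r j)))"
      using K(2)[of m n a "\<lambda>k. if k = j then 1 else 0"] that
      by (simp add: nrm_tensor_unit nrm_unit)
    have "1 \<le> D * norm (e (r j))"
    proof -
      have "1 = 1 / c * c" using c by simp
      also have "\<dots> \<le> D * norm (e (r j))"
        using D c cB by (intro mult_mono) auto
      finally show ?thesis .
    qed
    then have "?N * 1 \<le> ?N * (D * norm (e (r j)))" by (intro mult_left_mono) auto
    moreover have "?N * norm (e (r j)) \<le> ?N * D"
      using B[of "r j"] D by (intro mult_left_mono) auto
    ultimately show "comparable D (?N * norm (e (r j))) ?N"
      by (simp add: comparable_def mult_ac)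
  qed (use K D in auto)
  moreover have "1 \<le> K * D" using mult_mono[of 1 K 1 D] K D by simp
  ultimately show ?thesis by blast
qed

text \<open>
  If the constants were not uniform, witnesses of the failure could be glued, together with
  initial segments of \<open>e\<close>, into a single subsequence, each as an arithmetic progression.
\<close>

lemma spreading:
  "\<exists>C\<ge>1. \<forall>n l a. strict_mono l \<longrightarrow> comparable C (nrm (\<lambda>i. e (l i)) n a) (nrm e n a)"
proof (rule ccontr)
  assume contr: "\<not> ?thesis"
  have "\<exists>l n a. strict_mono l \<and> \<not> comparable (real k + 1) (nrm (\<lambda>i. e (l i)) n a) (nrm e n a)" for k
  proof -
    have "real k + 1 \<ge> 1" by simp
    then show ?thesis using contr by blast
  qed
  then obtain l n a where l: "\<And>k. strict_mono (l k)"
    and bad: "\<And>k. \<not> comparable (real k + 1) (nrm (\<lambda>i. e (l k i)) (n k) (a k)) (nrm e (n k) (a k))"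
    by metis
  \<comment> \<open>Even positions carry the witnesses of failure, odd ones the identity, so that
    \<open>l k\<close> and an initial segment of \<open>e\<close> both occur as progressions in the
    same \<open>h\<close>.\<close>
  define l' where "l' k = (if even k then l (k div 2) else (\<lambda>x. x))" for k
  have l': "strict_mono (l' k)" for k using l strict_mono_ident by (simp add: l'_def)
  obtain h where h: "strict_mono h" and
    h_prog: "\<And>k. \<exists>m p q. p < m \<and> q < m \<and> (\<forall>i<n (k div 2). h (i * m + p) = m * l' k i + q)"
    using glue_progressions[of l' "\<lambda>k. n (k div 2)", OF l'] by metis
  obtain C where C: "C \<ge> 1" "\<And>n m j a. j < m \<Longrightarrow>
    comparable C (nrm (\<lambda>i. e (h (i * m + j))) n a) (nrm (\<lambda>i. e (h i)) n a)"
    using progression_comparable[OF h] by blast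
  obtain D where D: "D \<ge> 1" "\<And>n m j a. j < m \<Longrightarrow>
    comparable D (nrm (\<lambda>i. e (i * m + j)) n a) (nrm e n a)"
    using progression_comparable[OF strict_mono_ident] by blast
  have key: "comparable (D * C) (nrm (\<lambda>i. e (l' k i)) (n (k div 2)) b)
      (nrm (\<lambda>i. e (h i)) (n (k div 2)) b)" for k b
  proof -
    obtain m p q where m: "p < m" "q < m"
      and hm: "\<And>i. i < n (k div 2) \<Longrightarrow> h (i * m + p) = m * l' k i + q"
      using h_prog by blast
    \<comment> \<open>\<open>D\<close> undoes the dilation by \<open>m\<close> and the shift by
      \<open>q\<close>, applied to coefficients padded with zeros in the gaps of
      \<open>l' k\<close>; \<open>C\<close> then passes from the progression in \<open>h\<close> to
      \<open>h\<close>.\<close>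
    obtain b' where b': "\<And>g. nrm g (l' k (n (k div 2))) b' = nrm (\<lambda>i. g (l' k i)) (n (k div 2)) b"
      using nrm_reindex[OF l'] by metis
    have "comparable D (nrm (\<lambda>i. e (i * m + q)) (l' k (n (k div 2))) b')
        (nrm e (l' k (n (k div 2))) b')"
      using D(2) m by blast
    then have "comparable D (nrm (\<lambda>i. e (l' k i)) (n (k div 2)) b)
        (nrm (\<lambda>i. e (h (i * m + p))) (n (k div 2)) b)"
      by (simp add: b' comparable_sym hm mult.commute cong: nrm_cong)
    then show ?thesis
      using C(1) D(1) by (intro comparable_trans[OF _ C(2)[OF m(1)]]) auto
  qed
  have "comparable ((D * C) * (D * C)) (nrm (\<lambda>i. e (l k i)) (n k) (a k)) (nrm e (n k) (a k))" for k
  proof (rule comparable_trans)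
    show "comparable (D * C) (nrm (\<lambda>i. e (l k i)) (n k) (a k)) (nrm (\<lambda>i. e (h i)) (n k) (a k))"
      using key[of "2 * k" "a k"] by (simp add: l'_def)
    show "comparable (D * C) (nrm (\<lambda>i. e (h i)) (n k) (a k)) (nrm e (n k) (a k))"
      using key[of "2 * k + 1" "a k"] by (simp add: l'_def comparable_sym)
  qed (use C D in auto)
  note uniform = this
  obtain k where k: "(D * C) * (D * C) \<le> real k"
    using real_arch_simple by blast
  have "comparable (real k + 1) (nrm (\<lambda>i. e (l k i)) (n k) (a k)) (nrm e (n k) (a k))"
    by (rule comparable_mono[OF uniform]) (use k in auto)
  with bad[of k] show False ..
qed

text \<open>
  The differences \<open>e (2 * i) - e (2 * i + 1)\<close> are equivalent to \<open>e\<close> (take the second factor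
  of the tensor product to be \<open>e 0 - e 1\<close>). Replacing the unwanted differences
  by the average of \<open>T\<close> consecutive spread copies telescopes them away as \<open>T\<close> grows.
\<close>

lemma suppression:
  "\<exists>C\<ge>0. \<forall>n A a. nrm e n (\<lambda>i. if i \<in> A then a i else 0) \<le> C * nrm e n a"
proof -
  obtain K where K: "K \<ge> 1" "\<And>n m a b. 0 < m \<Longrightarrow>
      comparable K (nrm e (n * m) (tensor m a b)) (nrm e n a * nrm e m b)"
    using tensor_comparable[OF strict_mono_ident] by blast
  obtain C where C: "C \<ge> 1"
    "\<And>n l a. strict_mono l \<Longrightarrow> comparable C (nrm (\<lambda>i. e (l i)) n a) (nrm e n a)"
    using spreading by blast
  obtain B where B: "\<And>i. norm (e i) \<le> B" using norm_upper by blast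
  have B0: "0 \<le> B" using norm_ge_zero[of "e 0"] B[of 0] by linarith
  define b where "b = (\<lambda>j::nat. if j = 0 then 1 else - 1 :: 'k)"
  define u where "u = norm (e 0 - e 1)"
  have u: "0 < u" using distinct by (simp add: u_def)
  have nrm_b: "nrm e 2 b = u"
    by (simp add: nrm_def b_def u_def lessThan_Suc numeral_2_eq_2 add.commute)
  have diff: "nrm f (n * 2) (tensor 2 a b) = norm (\<Sum>i<n. scl (a i) (f (2 * i) - f (2 * i + 1)))"
    for f n a
    unfolding nrm_tensor by (simp add: b_def lessThan_Suc numeral_2_eq_2 mult.commute add.commute)
  have main: "nrm e (n * 2) (tensor 2 (\<lambda>i. if i \<in> A then a i else 0) b)
      \<le> C * (C * nrm e (n * 2) (tensor 2 a b))" for n A a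
  proof -
    \<comment> \<open>In the stretched copy block \<open>i\<close> occupies the \<open>Suc T\<close>
      positions from \<open>i * Suc T\<close> on. \<open>X T\<close> holds the differences to be
      kept, \<open>Z T\<close> those to be removed.\<close>
    define X where "X T = (\<Sum>i<n. scl (if i \<in> A then a i else 0) (e (i * Suc T) - e (i * Suc T + T)))" for T
    define Z where "Z T = (\<Sum>i<n. scl (if i \<in> A then 0 else a i) (e (i * Suc T) - e (i * Suc T + T)))" for T
    define N where "N = nrm e (n * 2) (tensor 2 a b)"
    define M where "M = (\<Sum>i<n. norm (a i) * (2 * B))"
    have X_ge: "nrm e (n * 2) (tensor 2 (\<lambda>i. if i \<in> A then a i else 0) b) \<le> C * norm (X T)"
      if "1 \<le> T" for T
    proof -
      define l where "l k = k div 2 * Suc T + (if even k then 0 else T)" for k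
      have "strict_mono l"
        unfolding strict_mono_Suc_iff using that by (auto simp: l_def elim!: evenE oddE)
      then show ?thesis
        using C(2)[of l "n * 2" "tensor 2 (\<lambda>i. if i \<in> A then a i else 0) b"]
        by (simp add: diff comparable_def X_def l_def)
    qed
    \<comment> \<open>The bound does not depend on \<open>T\<close>, so \<open>Z T\<close>
      disappears after division by \<open>T\<close>.\<close>
    have Z_le: "norm (Z T) \<le> M" for T
      unfolding Z_def M_def
    proof (rule sum_norm_le)
      fix i
      have "norm (e (i * Suc T) - e (i * Suc T + T)) \<le> B + B"
        by (rule order_trans[OF norm_triangle_ineq4 add_mono[OF B B]])
      moreover have "norm (if i \<in> A then 0 else a i) \<le> norm (a i)" by simp
      ultimately show "norm (scl (if i \<in> A then 0 else a i) (e (i * Suc T) - e (i * Suc T + T)))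
          \<le> norm (a i) * (2 * B)"
        unfolding norm_scl by (intro mult_mono) auto
    qed
    have Y: "real T * norm (X T) \<le> real T * (C * N) + norm (Z T)" for T
    proof -
      \<comment> \<open>\<open>Y s\<close> has the full block difference for
        \<open>i \<in> A\<close> and the \<open>s\<close>-th consecutive difference for the other
        \<open>i\<close>. Each \<open>Y s\<close> is a spread copy of the whole difference vector,
        and the sum over \<open>s < T\<close> telescopes to \<open>T\<close> times
        \<open>X T\<close> plus \<open>Z T\<close>.\<close>
      define Y where "Y s = (\<Sum>i<n. scl (a i) (if i \<in> A then e (i * Suc T) - e (i * Suc T + T)
        else e (i * Suc T + s) - e (i * Suc T + Suc s)))" for s
      have Y_le: "norm (Y s) \<le> C * N" if "s < T" for s
      proof -
        define l where "l k = k div 2 * Suc T + (if k div 2 \<in> A then (if even k then 0 else T)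
          else (if even k then s else Suc s))" for k
        have "strict_mono l"
          unfolding strict_mono_Suc_iff using that by (auto simp: l_def elim!: evenE oddE)
        then have "nrm (\<lambda>i. e (l i)) (n * 2) (tensor 2 a b) \<le> C * N"
          using C(2)[of l "n * 2" "tensor 2 a b"] by (simp add: comparable_def N_def)
        also have "nrm (\<lambda>i. e (l i)) (n * 2) (tensor 2 a b) = norm (Y s)"
          unfolding diff Y_def
          by (intro arg_cong[where f = norm] sum.cong refl) (simp add: l_def)
        finally show ?thesis .
      qed
      have tele: "(\<Sum>s<T. e (i * Suc T + s) - e (i * Suc T + Suc s)) = e (i * Suc T) - e (i * Suc T + T)" for i
        using sum_lessThan_telescope'[of "\<lambda>s. e (i * Suc T + s)" T] by simp
      have "(\<Sum>s<T. Y s) = (\<Sum>i<n. \<Sum>s<T. scl (a i) (if i \<in> A then e (i * Suc T) - e (i * Suc T + T)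
        else e (i * Suc T + s) - e (i * Suc T + Suc s)))"
        unfolding Y_def by (rule sum.swap)
      also have "\<dots> = (\<Sum>i<n. scl (of_nat T) (scl (if i \<in> A then a i else 0) (e (i * Suc T) - e (i * Suc T + T)))
          + scl (if i \<in> A then 0 else a i) (e (i * Suc T) - e (i * Suc T + T)))"
      proof (intro sum.cong refl)
        fix i
        show "(\<Sum>s<T. scl (a i) (if i \<in> A then e (i * Suc T) - e (i * Suc T + T)
            else e (i * Suc T + s) - e (i * Suc T + Suc s))) =
          scl (of_nat T) (scl (if i \<in> A then a i else 0) (e (i * Suc T) - e (i * Suc T + T)))
            + scl (if i \<in> A then 0 else a i) (e (i * Suc T) - e (i * Suc T + T))"
        proof (cases "i \<in> A")
          case True
          then show ?thesis by (simp add: sum_constant_scale)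
        next
          case False
          then show ?thesis by (simp only: if_False scale_sum_right[symmetric] tele) simp
        qed
      qed
      also have "\<dots> = scl (of_nat T) (X T) + Z T"
        by (simp add: X_def Z_def sum.distrib scale_sum_right)
      finally have eq: "scl (of_nat T) (X T) = (\<Sum>s<T. Y s) - Z T" by simp
      have "real T * norm (X T) = norm ((\<Sum>s<T. Y s) - Z T)"
        by (simp add: norm_scl flip: eq)
      also have "\<dots> \<le> norm (\<Sum>s<T. Y s) + norm (Z T)" by (rule norm_triangle_ineq4)
      also have "norm (\<Sum>s<T. Y s) \<le> (\<Sum>s<T. C * N)"
        by (rule sum_norm_le) (simp add: Y_le)
      finally show ?thesis by simp
    qed
    have "nrm e (n * 2) (tensor 2 (\<lambda>i. if i \<in> A then a i else 0) b) \<le> C * (C * N + M / real (Suc T))" for T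
    proof -
      have "real (Suc T) * norm (X (Suc T)) \<le> real (Suc T) * (C * N) + M"
        using Y[of "Suc T"] Z_le[of "Suc T"] by linarith
      then have "norm (X (Suc T)) \<le> C * N + M / real (Suc T)"
        by (simp add: field_simps)
      then have "C * norm (X (Suc T)) \<le> C * (C * N + M / real (Suc T))"
        using C(1) by (intro mult_left_mono) auto
      then show ?thesis using X_ge[of "Suc T"] by simp
    qed
    moreover have "(\<lambda>T. C * (C * N + M / real (Suc T))) \<longlonglongrightarrow> C * (C * N + 0)"
      by (intro tendsto_intros LIMSEQ_Suc[OF lim_const_over_n])
    ultimately show ?thesis
      by (intro LIMSEQ_le_const[of "\<lambda>T. C * (C * N + M / real (Suc T))"]) (auto simp: N_def)
  qed
  have "nrm e n (\<lambda>i. if i \<in> A then a i else 0) \<le> (K * C * C * K) * nrm e n a" for n A a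
  proof -
    have "nrm e n (\<lambda>i. if i \<in> A then a i else 0) * u
        \<le> K * nrm e (n * 2) (tensor 2 (\<lambda>i. if i \<in> A then a i else 0) b)"
      using K(2)[of 2 n "\<lambda>i. if i \<in> A then a i else 0" b] by (simp add: comparable_def nrm_b)
    also have "\<dots> \<le> K * (C * (C * nrm e (n * 2) (tensor 2 a b)))"
      using main K(1) by (intro mult_left_mono) auto
    also have "\<dots> \<le> K * (C * (C * (K * (nrm e n a * u))))"
      using K(2)[of 2 n a b] K(1) C(1)
      by (intro mult_left_mono) (auto simp: comparable_def nrm_b)
    finally show ?thesis using u by (simp add: mult_ac)
  qed
  moreover have "0 \<le> K * C * C * K" using K(1) C(1) by simp
  ultimately show ?thesis by blast
qed

text \<open>Suppression handles multipliers with values 0 and 1. Convexity in each multiplier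
  separately gives values in [0,1], positive and negative parts give [-1,1], and expansion over
  \<open>Basis\<close> gives scalar multipliers of norm at most 1, at the cost of a factor
  \<open>DIM('k)\<close>.\<close>

lemma lattice_bound:
  "\<exists>D\<ge>1. \<forall>n a c. (\<forall>i<n. norm (c i) \<le> norm (a i)) \<longrightarrow> nrm e n c \<le> D * nrm e n a"
proof -
  obtain C where C: "C \<ge> 0"
    "\<And>n A a. nrm e n (\<lambda>i. if i \<in> A then a i else 0) \<le> C * nrm e n a"
    using suppression by blast
  \<comment> \<open>\<open>S\<close> contains the indices where \<open>t\<close> may be fractional.
    The value at one of them is a convex combination of 0 and 1, which removes it from
    \<open>S\<close>.\<close>
  have unit: "nrm e n (\<lambda>i. of_real (t i) * a i) \<le> C * nrm e n a"
    if "finite S" "\<And>i. i \<in> S \<Longrightarrow> 0 \<le> t i \<and> t i \<le> 1" "\<And>i. i \<notin> S \<Longrightarrow> t i = 0 \<or> t i = 1" for S n t a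
    using that
  proof (induction S arbitrary: t rule: finite_induct)
    case empty
    then have "(\<lambda>i. of_real (t i) * a i) = (\<lambda>i. if i \<in> {i. t i = 1} then a i else 0)" by force
    then show ?case using C(2) by metis
  next
    case (insert s S)
    define v where "v x = (\<lambda>i. of_real ((t(s := x)) i) * a i)" for x
    have le: "nrm e n (v x) \<le> C * nrm e n a" if "x = 0 \<or> x = 1" for x
      unfolding v_def using insert.prems that by (intro insert.IH) auto
    have ts: "0 \<le> t s" "t s \<le> 1" using insert.prems by auto
    have "(\<lambda>i. of_real (t i) * a i) = (\<lambda>i. of_real (t s) * v 1 i + of_real (1 - t s) * v 0 i)"
      by (auto simp: v_def fun_eq_iff algebra_simps)
    then have "nrm e n (\<lambda>i. of_real (t i) * a i) \<le>
        nrm e n (\<lambda>i. of_real (t s) * v 1 i) + nrm e n (\<lambda>i. of_real (1 - t s) * v 0 i)"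
      by (simp add: nrm_add_le)
    also have "\<dots> = t s * nrm e n (v 1) + (1 - t s) * nrm e n (v 0)"
      using ts by (simp only: nrm_scale norm_of_real)
    also have "\<dots> \<le> C * nrm e n a"
      using ts le[of 0] le[of 1] by (intro convex_bound_le) auto
    finally show ?case .
  qed
  have sgn: "nrm e n (\<lambda>i. of_real (t i) * a i) \<le> 2 * C * nrm e n a"
    if t: "\<And>i. \<bar>t i\<bar> \<le> 1" for n t a
  proof -
    define pos where "pos i = (if i < n then max 0 (t i) else 0)" for i
    define neg where "neg i = (if i < n then max 0 (- t i) else 0)" for i
    have "nrm e n (\<lambda>i. of_real (t i) * a i) =
        nrm e n (\<lambda>i. of_real (pos i) * a i + (- 1) * (of_real (neg i) * a i))"
      by (intro nrm_cong refl) (auto simp: pos_def neg_def max_def)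
    also have "\<dots> \<le> nrm e n (\<lambda>i. of_real (pos i) * a i) + nrm e n (\<lambda>i. (- 1) * (of_real (neg i) * a i))"
      by (rule nrm_add_le)
    also have "\<dots> = nrm e n (\<lambda>i. of_real (pos i) * a i) + nrm e n (\<lambda>i. of_real (neg i) * a i)"
      by (simp only: nrm_scale) simp
    also have "\<dots> \<le> C * nrm e n a + C * nrm e n a"
    proof (intro add_mono unit[of "{..<n}"])
      fix i
      show "0 \<le> pos i \<and> pos i \<le> 1" "0 \<le> neg i \<and> neg i \<le> 1"
        using t[of i] by (auto simp: pos_def neg_def)
    qed (auto simp: pos_def neg_def)
    finally show ?thesis by simp
  qed
  define D where "D = max 1 (real DIM('k) * (2 * C))"
  have "nrm e n c \<le> D * nrm e n a" if le: "\<And>i. i < n \<Longrightarrow> norm (c i) \<le> norm (a i)" for n a c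
  proof -
    define t where "t i = (if i < n then c i / a i else 0)" for i
    have t: "norm (t i) \<le> 1" for i
      using le[of i] by (auto simp: t_def norm_divide divide_le_eq_1)
    have "c i = t i * a i" if "i < n" for i
      using le[OF that] that by (auto simp: t_def)
    moreover have "t i = (\<Sum>b\<in>Basis. of_real (t i \<bullet> b) * b)" for i
      by (subst euclidean_representation[symmetric, of "t i"]) (simp add: scaleR_conv_of_real)
    ultimately have "nrm e n c = nrm e n (\<lambda>i. \<Sum>b\<in>Basis. b * (of_real (t i \<bullet> b) * a i))"
      by (intro nrm_cong refl) (metis (mono_tags, lifting) sum.cong mult.assoc mult.commute sum_distrib_right)
    also have "\<dots> \<le> (\<Sum>b\<in>Basis. nrm e n (\<lambda>i. b * (of_real (t i \<bullet> b) * a i)))"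
      by (rule nrm_sum_le)
    also have "\<dots> = (\<Sum>b\<in>(Basis::'k set). nrm e n (\<lambda>i. of_real (t i \<bullet> b) * a i))"
      by (simp only: nrm_scale) simp
    also have "\<dots> \<le> (\<Sum>b\<in>(Basis::'k set). 2 * C * nrm e n a)"
    proof (intro sum_mono sgn)
      fix b :: 'k and i assume "b \<in> Basis"
      then show "\<bar>t i \<bullet> b\<bar> \<le> 1" using Basis_le_norm[of b "t i"] t[of i] by linarith
    qed
    also have "\<dots> = (real DIM('k) * (2 * C)) * nrm e n a" by simp
    also have "\<dots> \<le> D * nrm e n a" by (intro mult_right_mono) (auto simp: D_def)
    finally show ?thesis .
  qed
  moreover have "1 \<le> D" by (simp add: D_def)
  ultimately show ?thesis by blast
qed

end

subsection \<open>Almost multiplicative growth\<close>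

lemma nonpos_if_multiples_bounded:
  fixes x E :: real
  assumes "\<And>j::nat. real j * x \<le> E"
  shows "x \<le> 0"
proof (rule ccontr)
  assume "\<not> x \<le> 0"
  then obtain j :: nat where "E < real j * x" using reals_Archimedean3 by (metis not_le)
  with assms[of j] show False by simp
qed

text \<open>The logarithm \<open>g\<close> satisfies \<open>g (n ^ j) = j * g n\<close> up to
  \<open>(j + 1) * k\<close>. Comparing powers of \<open>n\<close> and \<open>m\<close> by near
  monotonicity shows that every lower bound \<open>(g n - k) / ln n\<close> is at most every upper
  bound \<open>(g m + k) / ln m\<close>; \<open>\<theta>\<close> is chosen between them, so the
  constant \<open>K\<close> is preserved.\<close>

lemma almost_multiplicative_growth:
  fixes \<phi> :: "nat \<Rightarrow> real"
  assumes pos: "\<And>n. 1 \<le> n \<Longrightarrow> 0 < \<phi> n"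
    and K: "1 \<le> K" and mult: "\<And>n m. 1 \<le> n \<Longrightarrow> 1 \<le> m \<Longrightarrow> comparable K (\<phi> (n * m)) (\<phi> n * \<phi> m)"
    and D: "1 \<le> D" and mono: "\<And>n m. 1 \<le> n \<Longrightarrow> n \<le> m \<Longrightarrow> \<phi> n \<le> D * \<phi> m"
    and lin: "\<And>n. \<phi> n \<le> B * real n"
  obtains \<theta> where "0 \<le> \<theta>" "\<theta> \<le> 1" "\<And>n. 1 \<le> n \<Longrightarrow> comparable K (\<phi> n) (real n powr \<theta>)"
proof -
  define g where "g n = ln (\<phi> n)" for n
  define k where "k = ln K"
  have k0: "0 \<le> k" using K by (simp add: k_def)
  have gmult: "\<bar>g (n * m) - (g n + g m)\<bar> \<le> k" if "1 \<le> n" "1 \<le> m" for n m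
  proof -
    have p: "0 < \<phi> n" "0 < \<phi> m" "0 < \<phi> (n * m)" using that by (auto intro!: pos)
    have "ln (\<phi> (n * m)) \<le> ln (K * (\<phi> n * \<phi> m))" "ln (\<phi> n * \<phi> m) \<le> ln (K * \<phi> (n * m))"
      using mult[OF that] p K by (auto simp: comparable_def intro!: ln_mono mult_pos_pos)
    then show ?thesis using p K by (simp add: g_def k_def ln_mult)
  qed
  have g1: "\<bar>g 1\<bar> \<le> k" using gmult[of 1 1] by simp
  have gmono: "g n \<le> ln D + g m" if "1 \<le> n" "n \<le> m" for n m
  proof -
    have "ln (\<phi> n) \<le> ln (D * \<phi> m)"
      using mono[OF that] pos[of n] that by (intro ln_mono) auto
    then show ?thesis using pos[of m] that D by (simp add: g_def ln_mult)
  qed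
  have gpow: "\<bar>g (n ^ j) - real j * g n\<bar> \<le> (real j + 1) * k" if n: "1 \<le> n" for n j
  proof (induction j)
    case 0
    then show ?case using g1 by simp
  next
    case (Suc j)
    have "\<bar>g (n * n ^ j) - (g n + g (n ^ j))\<bar> \<le> k" using n by (intro gmult) auto
    then show ?case using Suc by (simp add: algebra_simps abs_le_iff)
  qed
  have lnpos: "0 < ln (real n)" if "2 \<le> n" for n using that by simp
  have cross: "(g n - k) / ln n \<le> (g m + k) / ln m" if n: "2 \<le> n" and m: "2 \<le> m" for n m
  proof -
    define L where "L = ln (real n) / ln (real m)"
    have L: "0 \<le> L" "L * ln m = ln n" using lnpos[OF m] lnpos[OF n] by (auto simp: L_def)
    have "real j * ((g n - k) - L * (g m + k)) \<le> ln D + 2 * k + \<bar>g m + k\<bar>" for j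
    proof -
      \<comment> \<open>The least \<open>i\<close> with \<open>n ^ j \<le> m ^ i\<close>. Rounding
        up costs at most \<open>\<bar>g m + k\<bar>\<close>, which vanishes after division by
        \<open>j\<close>.\<close>
      define i where "i = nat \<lceil>real j * L\<rceil>"
      have i: "real j * L \<le> real i" "real i \<le> real j * L + 1"
        using L by (auto simp: i_def)
      have "ln (real (n ^ j)) = real j * L * ln m" using n L by (simp add: ln_realpow)
      also have "\<dots> \<le> real i * ln m" using i lnpos[OF m] by (intro mult_right_mono) auto
      also have "\<dots> = ln (real (m ^ i))" using m by (simp add: ln_realpow)
      finally have "real (n ^ j) \<le> real (m ^ i)"
        using n m by (subst (asm) ln_le_cancel_iff) auto
      then have "n ^ j \<le> m ^ i" by (simp only: of_nat_le_iff)
      then have "g (n ^ j) \<le> ln D + g (m ^ i)" using n by (intro gmono) auto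
      moreover have "\<bar>g (n ^ j) - real j * g n\<bar> \<le> (real j + 1) * k" using n by (intro gpow) auto
      moreover have "\<bar>g (m ^ i) - real i * g m\<bar> \<le> (real i + 1) * k" using m by (intro gpow) auto
      ultimately have "real j * (g n - k) \<le> ln D + 2 * k + real i * (g m + k)"
        by (simp add: algebra_simps abs_le_iff)
      moreover have "(real i - real j * L) * (g m + k) \<le> (real i - real j * L) * \<bar>g m + k\<bar>"
        using i by (intro mult_left_mono) auto
      moreover have "\<dots> \<le> 1 * \<bar>g m + k\<bar>"
        using i by (intro mult_right_mono) auto
      ultimately show ?thesis by (simp add: algebra_simps)
    qed
    then have "(g n - k) - L * (g m + k) \<le> 0" by (rule nonpos_if_multiples_bounded)
    then show ?thesis using lnpos[OF n] lnpos[OF m] by (simp add: L_def field_simps)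
  qed
  define \<theta> where "\<theta> = (SUP n\<in>{2..}. (g n - k) / ln (real n))"
  have bdd: "bdd_above ((\<lambda>n. (g n - k) / ln (real n)) ` {2..})"
    by (rule bdd_aboveI2[where M = "(g 2 + k) / ln (real 2)"]) (rule cross, auto)
  have g_le: "g n \<le> \<theta> * ln n + k" and g_ge: "\<theta> * ln n \<le> g n + k" if "1 \<le> n" for n
  proof -
    have "g n \<le> \<theta> * ln n + k \<and> \<theta> * ln n \<le> g n + k"
    proof (cases "n = 1")
      case True
      then show ?thesis using g1 by (simp add: abs_le_iff)
    next
      case False
      then have n: "2 \<le> n" using that by simp
      have "(g n - k) / ln n \<le> \<theta>"
        unfolding \<theta>_def using n by (intro cSUP_upper bdd) auto
      moreover have "\<theta> \<le> (g n + k) / ln n"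
        unfolding \<theta>_def using n by (intro cSUP_least cross) auto
      ultimately show ?thesis using lnpos[OF n] by (simp add: field_simps)
    qed
    then show "g n \<le> \<theta> * ln n + k" "\<theta> * ln n \<le> g n + k" by auto
  qed
  have "comparable K (\<phi> n) (real n powr \<theta>)" if n: "1 \<le> n" for n
  proof -
    have e: "real n powr \<theta> = exp (\<theta> * ln n)" using n by (simp add: powr_def)
    have p: "\<phi> n = exp (g n)" "K = exp k" using pos[OF n] K by (simp_all add: g_def k_def)
    show ?thesis unfolding comparable_def e p exp_add[symmetric]
      using g_le[OF n] g_ge[OF n] by simp
  qed
  moreover have "0 \<le> \<theta>"
  proof -
    \<comment> \<open>Along powers of 2 near monotonicity bounds \<open>g\<close> below, so a
      negative \<open>\<theta>\<close> is impossible; the linear bound \<open>lin\<close> excludes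
      \<open>\<theta> > 1\<close> in the same way.\<close>
    have "real j * (- \<theta> * ln 2) \<le> ln D + 2 * k" for j
    proof -
      have "g 1 \<le> ln D + g (2 ^ j)" by (rule gmono) auto
      moreover have "g (2 ^ j) \<le> \<theta> * ln (real (2 ^ j)) + k" by (rule g_le) simp
      ultimately show ?thesis using g1 by (simp add: ln_realpow abs_le_iff algebra_simps)
    qed
    then have "- \<theta> * ln 2 \<le> 0" by (rule nonpos_if_multiples_bounded)
    then show ?thesis by (simp add: zero_le_mult_iff)
  qed
  moreover have "\<theta> \<le> 1"
  proof -
    have B: "0 < B" using lin[of 1] pos[of 1] by simp
    have "real j * ((\<theta> - 1) * ln 2) \<le> ln B + k" for j
    proof -
      have "\<theta> * ln (real (2 ^ j)) \<le> g (2 ^ j) + k" by (rule g_ge) simp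
      moreover have "g (2 ^ j) \<le> ln (B * real (2 ^ j))"
        unfolding g_def using lin[of "2 ^ j"] by (intro ln_mono) (auto intro: pos)
      ultimately show ?thesis using B by (simp add: ln_realpow ln_mult algebra_simps)
    qed
    then have "(\<theta> - 1) * ln 2 \<le> 0" by (rule nonpos_if_multiples_bounded)
    then show ?thesis by (simp add: mult_le_0_iff)
  qed
  ultimately show ?thesis using that by blast
qed

text \<open>Otherwise \<open>(N + 1) * (t / s) ^ N\<close> would tend to 0. This is the extraction
  of \<open>N\<close>-th roots that removes a factor linear in \<open>N\<close>.\<close>

lemma le_if_powers_le:
  fixes s t c :: real
  assumes s: "0 \<le> s" and t: "0 \<le> t" and le: "\<And>N::nat. s ^ N \<le> c * (real N + 1) * t ^ N"
  shows "s \<le> t"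
proof (rule ccontr)
  assume "\<not> s \<le> t"
  then have st: "t < s" by simp
  define x where "x = t / s"
  have x: "0 \<le> x" "x < 1" using st t by (auto simp: x_def)
  have "1 \<le> c * (real N * x ^ N + x ^ N)" for N
  proof -
    have "0 < s ^ N" using st t by simp
    then have "1 \<le> c * (real N + 1) * t ^ N / s ^ N" using le[of N] by simp
    then show ?thesis by (simp add: x_def power_divide add_divide_distrib algebra_simps)
  qed
  moreover have "(\<lambda>N. c * (real N * x ^ N + x ^ N)) \<longlonglongrightarrow> c * (0 + 0)"
    using x by (intro tendsto_intros powser_times_n_limit_0 LIMSEQ_realpow_zero) auto
  ultimately have "1 \<le> c * (0 + 0)" by (intro LIMSEQ_le_const) auto
  then show False by simp
qed

lemma strict_mono_enumeration:
  fixes A :: "nat set"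
  assumes "finite A"
  shows "\<exists>l. strict_mono l \<and> l ` {..<card A} = A"
  using assms
proof (induction A rule: finite_linorder_max_induct)
  case empty
  show ?case using strict_mono_ident by auto
next
  case (insert b A)
  then obtain l where l: "strict_mono l" "l ` {..<card A} = A" by blast
  \<comment> \<open>Past the maximum \<open>b\<close> the enumeration continues with consecutive
    integers, since \<open>spreading\<close> asks for a map that is strictly increasing on all of
    \<open>nat\<close>.\<close>
  define l' where "l' i = (if i < card A then l i else b + (i - card A))" for i
  have "l i < b" if "i < card A" for i using insert that l(2) by blast
  then have "strict_mono l'"
    using l(1) by (fastforce simp: strict_mono_def l'_def)
  moreover have "l' ` {..<card A} = l ` {..<card A}"
    by (rule image_cong) (auto simp: l'_def)
  moreover have "l' (card A) = b" "b \<notin> A" using insert by (auto simp: l'_def)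
  ultimately have "strict_mono l' \<and> l' ` {..<card (insert b A)} = insert b A"
    using insert(1) l(2) by (simp add: lessThan_Suc)
  then show ?case by blast
qed

subsection \<open>Tensor powers\<close>

text \<open>The first \<open>n ^ N\<close> entries are the coefficients of an \<open>N\<close>-fold
  product of \<open>a\<close>. For \<open>N = 0\<close> only index 0 counts, so the empty product
  stands for \<open>e 0\<close>, whose norm need not be 1.\<close>

definition tensor_power :: "nat \<Rightarrow> (nat \<Rightarrow> 'k::monoid_mult) \<Rightarrow> nat \<Rightarrow> nat \<Rightarrow> 'k" where
  "tensor_power n a N = rec_nat (\<lambda>_. 1) (\<lambda>N b. tensor (n ^ N) a b) N"

lemma tensor_power_simps [simp]:
  "tensor_power n a 0 = (\<lambda>_. 1)"
  "tensor_power n a (Suc N) = tensor (n ^ N) a (tensor_power n a N)"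
  by (simp_all add: tensor_power_def)

lemma sum_tensor_powr:
  fixes a b :: "nat \<Rightarrow> 'k::real_normed_field"
  shows "(\<Sum>k<n * m. norm (tensor m a b k) powr p) =
    (\<Sum>i<n. norm (a i) powr p) * (\<Sum>j<m. norm (b j) powr p)"
  unfolding sum_div_mod sum_product
  by (intro sum.cong refl) (auto simp: tensor_def norm_mult powr_mult)

lemma sum_tensor_power_powr:
  fixes a :: "nat \<Rightarrow> 'k::real_normed_field"
  shows "(\<Sum>k<n ^ N. norm (tensor_power n a N k) powr p) = (\<Sum>i<n. norm (a i) powr p) ^ N"
  by (induction N) (simp_all add: sum_tensor_powr)

text \<open>Logarithms of products add, so the range of dyadic levels grows only linearly in
  \<open>N\<close>.\<close>

lemma log_tensor_power_le:
  fixes a :: "nat \<Rightarrow> 'k::real_normed_field"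
  assumes L: "\<And>i. i < n \<Longrightarrow> a i \<noteq> 0 \<Longrightarrow> \<bar>log 2 (norm (a i))\<bar> \<le> L"
    and "k < n ^ N" "tensor_power n a N k \<noteq> 0"
  shows "\<bar>log 2 (norm (tensor_power n a N k))\<bar> \<le> real N * L"
  using assms(2,3)
proof (induction N arbitrary: k)
  case (Suc N)
  have n0: "0 < n ^ N" using Suc.prems(1) by (auto intro: Nat.gr0I)
  have nz: "a (k div n ^ N) \<noteq> 0" "tensor_power n a N (k mod n ^ N) \<noteq> 0"
    using Suc.prems by (auto simp: tensor_def)
  have "k div n ^ N < n" using Suc.prems(1) by (simp add: less_mult_imp_div_less)
  then have "\<bar>log 2 (norm (a (k div n ^ N)))\<bar> \<le> L" using nz by (intro L)
  moreover have "\<bar>log 2 (norm (tensor_power n a N (k mod n ^ N)))\<bar> \<le> real N * L"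
    using nz n0 by (intro Suc.IH) auto
  moreover have "log 2 (norm (tensor_power n a (Suc N) k)) =
      log 2 (norm (a (k div n ^ N))) + log 2 (norm (tensor_power n a N (k mod n ^ N)))"
    using nz by (simp add: tensor_def norm_mult log_mult)
  ultimately show ?case by (simp add: algebra_simps abs_le_iff)
qed simp

section \<open>Norms of indicator sequences and comparison with the norms of \<open>c0\<close> and
  \<open>lp\<close>\<close>

context tensor_seq
begin

definition char_seq :: "nat set \<Rightarrow> nat \<Rightarrow> 'k" where
  "char_seq A i = (if i \<in> A then 1 else 0)"

text \<open>\<open>A\<close> is the image of an initial segment under a strictly increasing map, to
  which \<open>spreading\<close> applies.\<close>

lemma char_seq_comparable:
  "\<exists>C\<ge>1. \<forall>n A. A \<subseteq> {..<n} \<longrightarrow> comparable C (nrm e n (char_seq A)) (nrm e (card A) (\<lambda>_. 1))"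
proof -
  obtain C where C: "C \<ge> 1"
    "\<And>n l a. strict_mono l \<Longrightarrow> comparable C (nrm (\<lambda>i. e (l i)) n a) (nrm e n a)"
    using spreading by blast
  have "comparable C (nrm e n (char_seq A)) (nrm e (card A) (\<lambda>_. 1))" if A: "A \<subseteq> {..<n}" for n A
  proof -
    have fin: "finite A" using A finite_subset by blast
    obtain l where l: "strict_mono l" "l ` {..<card A} = A"
      using strict_mono_enumeration[OF fin] by blast
    have "(\<Sum>i<n. scl (char_seq A i) (e i)) = (\<Sum>i\<in>A. e i)"
      using A by (intro sum.mono_neutral_cong_right) (auto simp: char_seq_def)
    also have "\<dots> = (\<Sum>i\<in>l ` {..<card A}. e i)" by (simp add: l(2))
    also have "\<dots> = (\<Sum>i<card A. e (l i))"
      by (subst sum.reindex) (auto intro: strict_mono_imp_inj_on[OF l(1)] inj_on_subset)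
    finally have "nrm e n (char_seq A) = nrm (\<lambda>i. e (l i)) (card A) (\<lambda>_. 1)"
      by (simp add: nrm_def)
    then show ?thesis using C(2)[OF l(1)] by simp
  qed
  then show ?thesis using C(1) by blast
qed

lemma growth:
  obtains \<theta> C where "0 \<le> \<theta>" "\<theta> \<le> 1" "1 \<le> C"
    "\<And>n A. A \<subseteq> {..<n} \<Longrightarrow> A \<noteq> {} \<Longrightarrow> comparable C (nrm e n (char_seq A)) (real (card A) powr \<theta>)"
proof -
  define \<phi> where "\<phi> n = nrm e n (\<lambda>_. 1)" for n
  obtain K where K: "K \<ge> 1" "\<And>n m a b. 0 < m \<Longrightarrow>
      comparable K (nrm e (n * m) (tensor m a b)) (nrm e n a * nrm e m b)"
    using tensor_comparable[OF strict_mono_ident] by blast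
  obtain D where D: "D \<ge> 1"
    "\<And>n a c. (\<And>i. i < n \<Longrightarrow> norm (c i) \<le> norm (a i)) \<Longrightarrow> nrm e n c \<le> D * nrm e n a"
    using lattice_bound by blast
  obtain B where B: "\<And>i. norm (e i) \<le> B" using norm_upper by blast
  obtain c where c: "c > 0" "\<And>i. c \<le> norm (e i)" using norm_lower by blast
  obtain F where F: "F \<ge> 1"
    "\<And>n A. A \<subseteq> {..<n} \<Longrightarrow> comparable F (nrm e n (char_seq A)) (nrm e (card A) (\<lambda>_. 1))"
    using char_seq_comparable by blast
  have mono: "\<phi> n \<le> D * \<phi> m" if "n \<le> m" for n m
  proof -
    have "\<phi> n = nrm e m (char_seq {..<n})"
      unfolding \<phi>_def nrm_def using that
      by (intro arg_cong[where f = norm] sum.mono_neutral_cong_left) (auto simp: char_seq_def)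
    also have "\<dots> \<le> D * \<phi> m" unfolding \<phi>_def by (rule D(2)) (simp add: char_seq_def)
    finally show ?thesis .
  qed
  have "0 < \<phi> n" if "1 \<le> n" for n
  proof -
    have "0 < \<phi> 1" using less_le_trans[OF c(1) c(2)[of 0]] by (simp add: \<phi>_def nrm_def)
    also have "\<phi> 1 \<le> D * \<phi> n" by (rule mono[OF that])
    finally show ?thesis using D(1) by (simp add: zero_less_mult_iff)
  qed
  \<comment> \<open>The tensor product of two constant sequences 1 is the constant sequence 1, so
    \<open>\<phi>\<close> inherits near multiplicativity.\<close>
  moreover have "comparable K (\<phi> (n * m)) (\<phi> n * \<phi> m)" if "1 \<le> m" for n m
    using K(2)[of m n "\<lambda>_. 1" "\<lambda>_. 1"] that by (simp add: \<phi>_def tensor_def[abs_def])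
  moreover have "\<phi> n \<le> B * real n" for n
    unfolding \<phi>_def using sum_bounded_above[of "{..<n}" "\<lambda>i. norm (e i)" B] B
    by (intro order_trans[OF nrm_le_sum]) (simp add: mult.commute)
  ultimately obtain \<theta> where \<theta>: "0 \<le> \<theta>" "\<theta> \<le> 1" "\<And>n. 1 \<le> n \<Longrightarrow> comparable K (\<phi> n) (real n powr \<theta>)"
    using almost_multiplicative_growth[of \<phi> K D B] K(1) D(1) mono by blast
  have "comparable (F * K) (nrm e n (char_seq A)) (real (card A) powr \<theta>)"
    if "A \<subseteq> {..<n}" "A \<noteq> {}" for n A
  proof (rule comparable_trans)
    show "comparable F (nrm e n (char_seq A)) (\<phi> (card A))"
      unfolding \<phi>_def by (rule F(2)[OF that(1)])
    have "finite A" using that(1) finite_subset by blast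
    then show "comparable K (\<phi> (card A)) (real (card A) powr \<theta>)"
      using that(2) by (intro \<theta>(3)) (simp add: Suc_le_eq card_gt_0_iff)
  qed (use F(1) K(1) in auto)
  moreover have "1 \<le> F * K" using mult_mono[of 1 F 1 K] F(1) K(1) by simp
  ultimately show ?thesis using that \<theta>(1,2) by blast
qed

text \<open>The case \<open>\<theta> = 0\<close>. By \<open>lattice_bound\<close>, \<open>a\<close>
  is dominated by \<open>c0_norm a\<close> times an indicator sequence of bounded norm, and it
  dominates each of its single coordinates.\<close>

lemma c0_comparable:
  assumes C: "1 \<le> C" "\<And>n A. A \<subseteq> {..<n} \<Longrightarrow> A \<noteq> {} \<Longrightarrow> nrm e n (char_seq A) \<le> C"
  shows "\<exists>M\<ge>1. \<forall>n a. (\<forall>i\<ge>n. a i = 0) \<longrightarrow> comparable M (nrm e n a) (c0_norm a)"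
proof -
  obtain D where D: "D \<ge> 1"
    "\<And>n a c. (\<And>i. i < n \<Longrightarrow> norm (c i) \<le> norm (a i)) \<Longrightarrow> nrm e n c \<le> D * nrm e n a"
    using lattice_bound by blast
  obtain c where c: "c > 0" "\<And>i. c \<le> norm (e i)" using norm_lower by blast
  define M where "M = max 1 (max (D * C) (D / c))"
  have M: "1 \<le> M" "D * C \<le> M" "D / c \<le> M" by (auto simp: M_def)
  have "comparable M (nrm e n a) (c0_norm a)" if a: "\<And>i. n \<le> i \<Longrightarrow> a i = 0" for n a
  proof -
    have "range (\<lambda>i. norm (a i)) \<subseteq> insert 0 ((\<lambda>i. norm (a i)) ` {..<n})"
    proof (rule image_subsetI)
      fix i
      show "norm (a i) \<in> insert 0 ((\<lambda>i. norm (a i)) ` {..<n})"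
        using a[of i] by (cases "i < n") auto
    qed
    then have "finite (range (\<lambda>i. norm (a i)))" by (rule finite_subset) simp
    then have bdd: "bdd_above (range (\<lambda>i. norm (a i)))" by simp
    have up: "norm (a i) \<le> c0_norm a" for i
      unfolding c0_norm_def by (rule cSUP_upper[OF _ bdd]) simp
    have s0: "0 \<le> c0_norm a" using up[of 0] norm_ge_zero order_trans by blast
    have "nrm e n a \<le> D * nrm e n (\<lambda>i. of_real (c0_norm a) * char_seq {..<n} i)"
      using up s0 by (intro D(2)) (simp add: char_seq_def norm_mult)
    also have "\<dots> = D * (c0_norm a * nrm e n (char_seq {..<n}))"
      using s0 by (simp add: nrm_scale)
    also have "\<dots> \<le> D * (c0_norm a * C)"
    proof (cases "n = 0")
      case True
      then show ?thesis using D(1) s0 C(1) by (simp add: nrm_def)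
    next
      case False
      then show ?thesis using D(1) s0 C(2)[of "{..<n}" n] by (intro mult_left_mono) auto
    qed
    also have "\<dots> = (D * C) * c0_norm a" by simp
    also have "\<dots> \<le> M * c0_norm a" using M s0 by (intro mult_right_mono)
    finally have 1: "nrm e n a \<le> M * c0_norm a" .
    have "norm (a i) \<le> M * nrm e n a" for i
    proof (cases "i < n")
      case True
      have "norm (a i) * c \<le> norm (a i) * norm (e i)" using c by (intro mult_left_mono) auto
      also have "\<dots> = nrm e n (\<lambda>k. a i * (if k = i then 1 else 0))"
        unfolding nrm_scale nrm_unit[OF True] ..
      also have "\<dots> \<le> D * nrm e n a" by (rule D(2)) auto
      finally have "norm (a i) \<le> D / c * nrm e n a" using c(1) by (simp add: field_simps)
      also have "\<dots> \<le> M * nrm e n a" using M by (intro mult_right_mono) auto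
      finally show ?thesis .
    next
      case False
      then show ?thesis using a M by simp
    qed
    then have "c0_norm a \<le> M * nrm e n a" unfolding c0_norm_def by (intro cSUP_least) auto
    with 1 show ?thesis by (simp add: comparable_def)
  qed
  then show ?thesis using M(1) by blast
qed

text \<open>On a dyadic level set \<open>a\<close> is within a factor 2 of a multiple of an
  indicator sequence, whose norm is known. At most \<open>2 * L + 2\<close> levels are nonempty, and
  summing over them loses this number.\<close>

lemma level_sets_comparable:
  assumes \<theta>: "0 < \<theta>" "\<theta> \<le> 1" and E: "1 \<le> E"
    "\<And>n A. A \<subseteq> {..<n} \<Longrightarrow> A \<noteq> {} \<Longrightarrow> comparable E (nrm e n (char_seq A)) (real (card A) powr \<theta>)"
  shows "\<exists>F\<ge>1. \<forall>n a L. 0 \<le> L \<longrightarrow> (\<forall>i<n. a i \<noteq> 0 \<longrightarrow> \<bar>log 2 (norm (a i))\<bar> \<le> L) \<longrightarrow>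
    comparable ((2 * L + 2) * F) (nrm e n a) ((\<Sum>i<n. norm (a i) powr (1 / \<theta>)) powr \<theta>)"
proof -
  obtain D where D: "D \<ge> 1"
    "\<And>n a c. (\<And>i. i < n \<Longrightarrow> norm (c i) \<le> norm (a i)) \<Longrightarrow> nrm e n c \<le> D * nrm e n a"
    using lattice_bound by blast
  define F where "F = 2 * E * D * D"
  have DE: "0 \<le> D" "0 \<le> E" using D E by auto
  have "1 \<le> E * (D * D)" using mult_mono[of 1 D 1 D] mult_mono[of 1 E 1 "D * D"] D E by simp
  then have F1: "1 \<le> F" by (simp add: F_def mult_ac)
  have main: "comparable ((2 * L + 2) * F) (nrm e n a) ((\<Sum>i<n. norm (a i) powr (1 / \<theta>)) powr \<theta>)"
    if L0: "0 \<le> L" and L: "\<And>i. i < n \<Longrightarrow> a i \<noteq> 0 \<Longrightarrow> \<bar>log 2 (norm (a i))\<bar> \<le> L" for n a L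
  proof -
    define p where "p = 1 / \<theta>"
    have p: "0 < p" "p * \<theta> = 1" using \<theta> by (simp_all add: p_def)
    define W where "W = (\<Sum>i<n. norm (a i) powr p)"
    have W0: "0 \<le> W" by (simp add: W_def sum_nonneg)
    define lev where "lev i = \<lfloor>log 2 (norm (a i))\<rfloor>" for i
    define I where "I = lev ` {i. i < n \<and> a i \<noteq> 0}"
    define A where "A k = {i. i < n \<and> a i \<noteq> 0 \<and> lev i = k}" for k
    have finI: "finite I" by (simp add: I_def)
    \<comment> \<open>The levels are integers from \<open>\<lfloor>- L\<rfloor>\<close> to
      \<open>\<lfloor>L\<rfloor>\<close>; the two roundings account for the \<open>+ 2\<close> in
      the count.\<close>
    have "I \<subseteq> {\<lfloor>- L\<rfloor>..\<lfloor>L\<rfloor>}"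
      using L by (force simp: I_def lev_def abs_le_iff intro!: floor_mono)
    then have "card I \<le> card {\<lfloor>- L\<rfloor>..\<lfloor>L\<rfloor>}" by (intro card_mono) auto
    also have "\<dots> = nat (\<lfloor>L\<rfloor> - \<lfloor>- L\<rfloor> + 1)" by simp
    finally have "real (card I) \<le> real (nat (\<lfloor>L\<rfloor> - \<lfloor>- L\<rfloor> + 1))" by (simp only: of_nat_le_iff)
    also have "\<dots> \<le> 2 * L + 2" using L0 by linarith
    finally have cardI: "real (card I) \<le> 2 * L + 2" .
    have A: "A k \<subseteq> {..<n}" "finite (A k)" for k by (auto simp: A_def)
    have A_ne: "A k \<noteq> {}" if "k \<in> I" for k using that by (auto simp: A_def I_def)
    have bounds: "2 powr k \<le> norm (a i)" "norm (a i) \<le> 2 * 2 powr k" if "i \<in> A k" for i k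
    proof -
      have nz: "0 < norm (a i)" and k: "k = \<lfloor>log 2 (norm (a i))\<rfloor>"
        using that by (auto simp: A_def lev_def)
      have "real_of_int k \<le> log 2 (norm (a i))" "log 2 (norm (a i)) \<le> real_of_int k + 1"
        unfolding k by linarith+
      then show "2 powr k \<le> norm (a i)" "norm (a i) \<le> 2 * 2 powr k"
        using nz by (simp_all add: le_log_iff log_le_iff powr_add mult.commute)
    qed
    \<comment> \<open>Up to constants, \<open>w k\<close> is both the norm and the
      \<open>p\<close>-norm of the part of \<open>a\<close> on level \<open>k\<close>.\<close>
    define w where "w k = 2 powr real_of_int k * real (card (A k)) powr \<theta>" for k
    have char_nrm: "comparable E (nrm e n (char_seq (A k))) (real (card (A k)) powr \<theta>)" if "k \<in> I" for k
      by (rule E(2)[OF A(1) A_ne[OF that]])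
    have powr_p: "(2 powr real_of_int k) powr p * real (card (A k)) = w k powr p" for k
      using p by (simp add: w_def powr_mult powr_powr mult.commute[of \<theta>])
    have piece: "nrm e n (\<lambda>i. if i \<in> A k then a i else 0) \<le> F * W powr \<theta>" if k: "k \<in> I" for k
    proof -
      have "nrm e n (\<lambda>i. if i \<in> A k then a i else 0) \<le>
          D * nrm e n (\<lambda>i. of_real (2 * 2 powr k) * char_seq (A k) i)"
        using bounds by (intro D(2)) (auto simp: char_seq_def norm_mult)
      also have "\<dots> = D * (2 * 2 powr k * nrm e n (char_seq (A k)))"
        unfolding nrm_scale norm_of_real by simp
      also have "\<dots> \<le> D * (2 * 2 powr k * (E * real (card (A k)) powr \<theta>))"
        using char_nrm[OF k] DE by (intro mult_left_mono) (auto simp: comparable_def)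
      also have "\<dots> = 2 * E * D * w k" by (simp add: w_def)
      also have "w k = (w k powr p) powr \<theta>" using p by (simp add: powr_powr w_def)
      also have "\<dots> \<le> W powr \<theta>"
      proof (rule powr_mono2)
        have "w k powr p = (\<Sum>i\<in>A k. (2 powr real_of_int k) powr p)" by (simp flip: powr_p)
        also have "\<dots> \<le> (\<Sum>i\<in>A k. norm (a i) powr p)"
          using bounds p by (intro sum_mono powr_mono2) auto
        also have "\<dots> \<le> W" unfolding W_def using A by (intro sum_mono2) auto
        finally show "w k powr p \<le> W" .
      qed (use \<theta> in auto)
      also have "2 * E * D * W powr \<theta> \<le> F * W powr \<theta>"
        using D(1) DE mult_left_mono[of 1 D "2 * E * D"] by (intro mult_right_mono) (auto simp: F_def)
      finally show ?thesis using DE by (simp add: mult_left_mono)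
    qed
    \<comment> \<open>Each nonzero coefficient lies on exactly one level. The type of
      \<open>x\<close> is left general because the identity serves both the coefficients and their
      real powers.\<close>
    have split: "(\<Sum>k\<in>I. if i \<in> A k then x else 0) = x" if "i < n" "a i \<noteq> 0"
      for i and x :: "'c::comm_monoid_add"
    proof -
      have "(\<Sum>k\<in>I. if i \<in> A k then x else 0) = (\<Sum>k\<in>I. if k = lev i then x else 0)"
        using that by (intro sum.cong refl) (auto simp: A_def)
      also have "\<dots> = x" using that finI by (auto simp: I_def)
      finally show ?thesis .
    qed
    have "nrm e n a = nrm e n (\<lambda>i. \<Sum>k\<in>I. if i \<in> A k then a i else 0)"
    proof (rule nrm_cong)
      fix i assume "i < n"
      then show "a i = (\<Sum>k\<in>I. if i \<in> A k then a i else 0)"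
        using split[of i "a i"] by (cases "a i = 0") (auto simp: A_def)
    qed simp
    also have "\<dots> \<le> (\<Sum>k\<in>I. nrm e n (\<lambda>i. if i \<in> A k then a i else 0))" by (rule nrm_sum_le)
    also have "\<dots> \<le> (\<Sum>k\<in>I. F * W powr \<theta>)" by (intro sum_mono piece)
    also have "\<dots> = real (card I) * (F * W powr \<theta>)" by simp
    also have "\<dots> \<le> (2 * L + 2) * (F * W powr \<theta>)"
      using cardI F1 by (intro mult_right_mono) auto
    finally have upper: "nrm e n a \<le> (2 * L + 2) * F * W powr \<theta>" by (simp add: mult_ac)
    have low_piece: "(\<Sum>i\<in>A k. norm (a i) powr p) \<le> (F * nrm e n a) powr p" if k: "k \<in> I" for k
    proof -
      have "w k \<le> 2 powr k * (E * nrm e n (char_seq (A k)))"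
        unfolding w_def using char_nrm[OF k] by (intro mult_left_mono) (auto simp: comparable_def)
      also have "\<dots> = E * nrm e n (\<lambda>i. of_real (2 powr k) * char_seq (A k) i)"
        unfolding nrm_scale norm_of_real by simp
      also have "\<dots> \<le> E * (D * nrm e n a)"
        using DE bounds by (intro mult_left_mono D(2)) (auto simp: char_seq_def norm_mult)
      also have "\<dots> \<le> E * (D * (D * nrm e n a))"
        using D(1) DE mult_right_mono[of 1 D "nrm e n a"] by (intro mult_left_mono) auto
      finally have w: "2 * w k \<le> F * nrm e n a" by (simp add: F_def mult_ac)
      have "(\<Sum>i\<in>A k. norm (a i) powr p) \<le> (\<Sum>i\<in>A k. (2 * 2 powr real_of_int k) powr p)"
        using bounds p by (intro sum_mono powr_mono2) auto
      also have "\<dots> = (2 * w k) powr p"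
        by (simp add: powr_mult mult_ac flip: powr_p)
      also have "\<dots> \<le> (F * nrm e n a) powr p"
        using w p by (intro powr_mono2) (auto simp: w_def)
      finally show ?thesis .
    qed
    have "W = (\<Sum>i<n. \<Sum>k\<in>I. if i \<in> A k then norm (a i) powr p else 0)"
      unfolding W_def
    proof (intro sum.cong refl)
      fix i assume "i \<in> {..<n}"
      then show "norm (a i) powr p = (\<Sum>k\<in>I. if i \<in> A k then norm (a i) powr p else 0)"
        using split[of i "norm (a i) powr p"] by (cases "a i = 0") (auto simp: A_def)
    qed
    also have "\<dots> = (\<Sum>k\<in>I. \<Sum>i<n. if i \<in> A k then norm (a i) powr p else 0)" by (rule sum.swap)
    also have "\<dots> = (\<Sum>k\<in>I. \<Sum>i\<in>A k. norm (a i) powr p)"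
      by (intro sum.cong refl sum.mono_neutral_cong_right) (use A in auto)
    also have "\<dots> \<le> (\<Sum>k\<in>I. (F * nrm e n a) powr p)" by (intro sum_mono low_piece)
    also have "\<dots> = real (card I) * (F * nrm e n a) powr p" by simp
    also have "\<dots> \<le> (2 * L + 2) * (F * nrm e n a) powr p"
      using cardI by (intro mult_right_mono) auto
    finally have "W powr \<theta> \<le> ((2 * L + 2) * (F * nrm e n a) powr p) powr \<theta>"
      using W0 \<theta> by (intro powr_mono2) auto
    also have "\<dots> = (2 * L + 2) powr \<theta> * (F * nrm e n a)"
      using p F1 L0 by (simp add: powr_mult powr_powr)
    \<comment> \<open>The exponent may be raised from \<open>\<theta>\<close> to 1 because the base
      is at least 1.\<close>
    also have "\<dots> \<le> (2 * L + 2) powr 1 * (F * nrm e n a)"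
      using \<theta> L0 F1 by (intro mult_right_mono powr_mono) auto
    finally have "W powr \<theta> \<le> (2 * L + 2) * F * nrm e n a" using L0 by (simp add: mult_ac)
    with upper show ?thesis by (simp add: comparable_def W_def p_def)
  qed
  show ?thesis using F1 main by blast
qed

text \<open>
  The factor lost by splitting into dyadic level sets grows only linearly under tensor powers, so
  applying the estimate to \<open>tensor_power n a N\<close> and taking \<open>N\<close>-th roots removes it.
\<close>

lemma lp_comparable:
  assumes \<theta>: "0 < \<theta>" "\<theta> \<le> 1" and E: "1 \<le> E"
    "\<And>n A. A \<subseteq> {..<n} \<Longrightarrow> A \<noteq> {} \<Longrightarrow> comparable E (nrm e n (char_seq A)) (real (card A) powr \<theta>)"
  shows "\<exists>K\<ge>1. \<forall>n a. comparable K (nrm e n a) ((\<Sum>i<n. norm (a i) powr (1 / \<theta>)) powr \<theta>)"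
proof -
  obtain F where F: "F \<ge> 1" "\<And>n a L. 0 \<le> L \<Longrightarrow>
      (\<And>i. i < n \<Longrightarrow> a i \<noteq> 0 \<Longrightarrow> \<bar>log 2 (norm (a i))\<bar> \<le> L) \<Longrightarrow>
      comparable ((2 * L + 2) * F) (nrm e n a) ((\<Sum>i<n. norm (a i) powr (1 / \<theta>)) powr \<theta>)"
    using level_sets_comparable[OF assms] by blast
  obtain K where K: "K \<ge> 1" "\<And>n m a b. 0 < m \<Longrightarrow>
      comparable K (nrm e (n * m) (tensor m a b)) (nrm e n a * nrm e m b)"
    using tensor_comparable[OF strict_mono_ident] by blast
  obtain c where c: "c > 0" "\<And>i. c \<le> norm (e i)" using norm_lower by blast
  define u where "u = norm (e 0)"
  have u: "0 < u" using less_le_trans[OF c(1) c(2)[of 0]] by (simp add: u_def)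
  have "comparable K (nrm e n a) ((\<Sum>i<n. norm (a i) powr (1 / \<theta>)) powr \<theta>)" for n a
  proof (cases "n = 0")
    case True
    then show ?thesis by (simp add: nrm_def comparable_def)
  next
    case False
    define W where "W = (\<Sum>i<n. norm (a i) powr (1 / \<theta>))"
    have W0: "0 \<le> W" by (simp add: W_def sum_nonneg)
    \<comment> \<open>\<open>L\<close> depends on \<open>a\<close>, but it enters only through the
      factor that \<open>le_if_powers_le\<close> removes; hence the final constant is the
      \<open>K\<close> of the tensor estimate.\<close>
    define L where "L = (\<Sum>i<n. \<bar>log 2 (norm (a i))\<bar>)"
    have L0: "0 \<le> L" by (simp add: L_def sum_nonneg)
    have L: "\<bar>log 2 (norm (a i))\<bar> \<le> L" if "i < n" for i
      unfolding L_def using that by (intro member_le_sum) auto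
    \<comment> \<open>The factor \<open>u\<close> is the norm of the empty product
      \<open>e 0\<close>.\<close>
    have power: "comparable (K ^ N) (nrm e (n ^ N) (tensor_power n a N)) (nrm e n a ^ N * u)" for N
    proof (induction N)
      case 0
      then show ?case by (simp add: nrm_def u_def comparable_def)
    next
      case (Suc N)
      let ?x = "nrm e (n ^ N) (tensor_power n a N)"
      have "comparable (K * K ^ N) (nrm e (n * n ^ N) (tensor (n ^ N) a (tensor_power n a N)))
          (nrm e n a * (nrm e n a ^ N * u))"
      proof (rule comparable_trans)
        show "comparable K (nrm e (n * n ^ N) (tensor (n ^ N) a (tensor_power n a N))) (nrm e n a * ?x)"
          using False by (intro K(2)) simp
        have "nrm e n a * ?x \<le> nrm e n a * (K ^ N * (nrm e n a ^ N * u))"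
          "nrm e n a * (nrm e n a ^ N * u) \<le> nrm e n a * (K ^ N * ?x)"
          using Suc by (auto simp: comparable_def intro!: mult_left_mono)
        then show "comparable (K ^ N) (nrm e n a * ?x) (nrm e n a * (nrm e n a ^ N * u))"
          by (simp add: comparable_def mult_ac)
      qed (use K(1) in auto)
      then show ?case by (simp add: mult_ac)
    qed
    have est: "comparable ((2 * (real N * L) + 2) * F) (nrm e (n ^ N) (tensor_power n a N)) ((W powr \<theta>) ^ N)" for N
    proof -
      have "(W ^ N) powr \<theta> = (W powr \<theta>) ^ N"
        using W0 by (induction N) (simp_all add: powr_mult)
      then show ?thesis
        using F(2)[of "real N * L" "n ^ N" "tensor_power n a N"] log_tensor_power_le[of n a L _ N] L L0
        by (simp add: sum_tensor_power_powr W_def)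
    qed
    have both: "comparable (K ^ N * ((2 * (real N * L) + 2) * F)) (nrm e n a ^ N * u) ((W powr \<theta>) ^ N)" for N
      by (rule comparable_trans[OF comparable_sym[OF power] est]) (use K F(1) L0 in auto)
    \<comment> \<open>The loss from the dyadic decomposition is linear in \<open>N\<close>, as
      \<open>le_if_powers_le\<close> requires.\<close>
    have cst: "(2 * (real N * L) + 2) * F \<le> (2 * L + 2) * F * (real N + 1)" for N
    proof -
      have "2 * (real N * L) + 2 \<le> (2 * L + 2) * (real N + 1)" using L0 by (simp add: algebra_simps)
      then show ?thesis using F(1) mult_right_mono[of _ _ F] by (simp add: mult_ac)
    qed
    have "nrm e n a \<le> K * W powr \<theta>"
    proof (rule le_if_powers_le)
      fix N
      have "nrm e n a ^ N * u \<le> K ^ N * ((2 * (real N * L) + 2) * F) * (W powr \<theta>) ^ N"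
        using both[of N] by (simp add: comparable_def)
      also have "\<dots> \<le> K ^ N * ((2 * L + 2) * F * (real N + 1)) * (W powr \<theta>) ^ N"
        using cst K(1) by (intro mult_right_mono mult_left_mono) auto
      finally show "nrm e n a ^ N \<le> (2 * L + 2) * F / u * (real N + 1) * (K * W powr \<theta>) ^ N"
        using u by (simp add: power_mult_distrib field_simps)
    qed (use K(1) in auto)
    moreover have "W powr \<theta> \<le> K * nrm e n a"
    proof (rule le_if_powers_le)
      fix N
      have "(W powr \<theta>) ^ N \<le> K ^ N * ((2 * (real N * L) + 2) * F) * (nrm e n a ^ N * u)"
        using both[of N] by (simp add: comparable_def)
      also have "\<dots> \<le> K ^ N * ((2 * L + 2) * F * (real N + 1)) * (nrm e n a ^ N * u)"
        using cst K(1) u by (intro mult_right_mono mult_left_mono) auto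
      finally show "(W powr \<theta>) ^ N \<le> (2 * L + 2) * F * u * (real N + 1) * (K * nrm e n a) ^ N"
        by (simp add: power_mult_distrib mult_ac)
    qed (use K(1) in auto)
    ultimately show ?thesis by (simp add: comparable_def W_def)
  qed
  then show ?thesis using K(1) by blast
qed

end

subsection \<open>Identification of the unit vector basis\<close>

text \<open>\<open>seq_mult\<close> takes its block length from the last nonzero coefficient of the
  second factor, which gives the case \<open>b (m - 1) \<noteq> 0\<close>. The other case follows by
  continuity of both sides in that coefficient.\<close>

lemma (in scaled_norm) tensor_comparable_if_seq_mult:
  assumes inj: "inj f" and ind: "independent (range f)"
    and mult: "\<And>\<alpha> \<beta>. \<alpha> \<in> span (range f) \<Longrightarrow> \<beta> \<in> span (range f) \<Longrightarrow>
      comparable K (norm (seq_mult scl f \<alpha> \<beta>)) (norm \<alpha> * norm \<beta>)"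
    and m: "0 < m"
  shows "comparable K (nrm f (n * m) (tensor m a b)) (nrm f n a * nrm f m b)"
proof -
  have in_span: "(\<Sum>i<n. scl (a i) (f i)) \<in> span (range f)" for n a
    by (intro span_sum span_scale span_base) auto
  have nz: "comparable K (nrm f (n * m) (tensor m a b)) (nrm f n a * nrm f m b)"
    if "b (m - 1) \<noteq> 0" for b
    using mult[OF in_span[of a n] in_span[of b m]]
    unfolding seq_mult_expansion[where b = b, OF vector_space_axioms inj ind m that] nrm_tensor
    by (simp add: nrm_def)
  define \<delta> where "\<delta> k = (of_real (1 / real (Suc k)) :: 'k)" for k
  have \<delta>_nz: "\<delta> k \<noteq> 0" for k by (simp add: \<delta>_def del: of_real_divide of_nat_Suc)
  have "\<delta> \<longlonglongrightarrow> of_real 0"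
    unfolding \<delta>_def by (intro tendsto_of_real LIMSEQ_Suc[OF lim_const_over_n])
  then have \<delta>_lim: "(\<lambda>k. x + \<delta> k) \<longlonglongrightarrow> x" for x
    using tendsto_add[OF tendsto_const[of x]] by fastforce
  \<comment> \<open>Only a vanishing last coefficient is perturbed, to the nonzero value
    \<open>\<delta> k\<close>, so that \<open>nz\<close> applies to every
    \<open>b' k\<close>.\<close>
  define b' where "b' k i = (if i = m - 1 \<and> b i = 0 then b i + \<delta> k else b i)" for k i
  have b'_lim: "(\<lambda>k. b' k i) \<longlonglongrightarrow> b i" for i
  proof (cases "i = m - 1 \<and> b i = 0")
    case True
    then have "(\<lambda>k. b' k i) = (\<lambda>k. b i + \<delta> k)" by (auto simp: b'_def)
    then show ?thesis by (simp only: \<delta>_lim)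
  next
    case False
    then have "(\<lambda>k. b' k i) = (\<lambda>_. b i)" by (intro ext) (simp only: b'_def if_False)
    then show ?thesis by (simp only: tendsto_const)
  qed
  have cmp: "comparable K (nrm f (n * m) (tensor m a (b' k))) (nrm f n a * nrm f m (b' k))" for k
    by (rule nz) (simp add: b'_def \<delta>_nz)
  have lim1: "(\<lambda>k. nrm f (n * m) (tensor m a (b' k))) \<longlonglongrightarrow> nrm f (n * m) (tensor m a b)"
    unfolding tensor_def by (intro tendsto_nrm tendsto_intros b'_lim)
  have lim2: "(\<lambda>k. nrm f n a * nrm f m (b' k)) \<longlonglongrightarrow> nrm f n a * nrm f m b"
    by (intro tendsto_nrm tendsto_intros b'_lim)
  show ?thesis
    unfolding comparable_def
  proof
    show "nrm f (n * m) (tensor m a b) \<le> K * (nrm f n a * nrm f m b)"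
      using cmp by (intro LIMSEQ_le[OF lim1 tendsto_mult_left[OF lim2]]) (auto simp: comparable_def)
    show "nrm f n a * nrm f m b \<le> K * nrm f (n * m) (tensor m a b)"
      using cmp by (intro LIMSEQ_le[OF lim2 tendsto_mult_left[OF lim1]]) (auto simp: comparable_def)
  qed
qed

lemma (in scaled_norm) equivalent_unit_vec_if_comparable:
  fixes N :: "(nat \<Rightarrow> 'k) \<Rightarrow> real"
  assumes C: "1 \<le> C" "\<And>n a. (\<And>i. n \<le> i \<Longrightarrow> a i = 0) \<Longrightarrow> comparable C (nrm f n a) (N a)"
  shows "equivalent_seqs scl norm f seq_scale N unit_vec"
  unfolding equivalent_seqs_def
proof (intro exI conjI allI impI)
  show "0 < C" using C by simp
  fix a :: "nat \<Rightarrow> 'k" assume fin: "finite {i. a i \<noteq> 0}"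
  obtain n where n: "{i. a i \<noteq> 0} \<subseteq> {..<n}"
    using fin finite_nat_iff_bounded by blast
  have "(\<Sum>i | a i \<noteq> 0. scl (a i) (f i)) = (\<Sum>i<n. scl (a i) (f i))"
    using n by (intro sum.mono_neutral_left) auto
  then have eq: "norm (\<Sum>i | a i \<noteq> 0. scl (a i) (f i)) = nrm f n a" by (simp add: nrm_def)
  have "a i = 0" if "n \<le> i" for i using n that by (auto simp: subset_iff not_less[symmetric])
  then have "comparable C (nrm f n a) (N a)" by (rule C(2))
  then show "1 / C * norm (\<Sum>i | a i \<noteq> 0. scl (a i) (f i))
      \<le> N (\<Sum>i | a i \<noteq> 0. seq_scale (a i) (unit_vec i))"
    "N (\<Sum>i | a i \<noteq> 0. seq_scale (a i) (unit_vec i)) \<le> C * norm (\<Sum>i | a i \<noteq> 0. scl (a i) (f i))"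
    unfolding eq sum_unit_vec[OF fin] using C(1) by (auto simp: comparable_def field_simps)
qed

theorem theorem14:
  fixes scl :: "'k::{real_normed_field, euclidean_space} \<Rightarrow> 'a::banach \<Rightarrow> 'a"
    and e :: "nat \<Rightarrow> 'a"
  assumes "vector_space scl"
    and "\<And>c x. norm (scl c x) = norm c * norm x"
    and "basic_sequence scl e"
    and "semi_normalized e"
    and "\<And>r f. strict_mono r \<Longrightarrow> f = e \<circ> r \<Longrightarrow>
           \<exists>K>0. \<forall>\<alpha> \<in> module.span scl (range f). \<forall>\<beta> \<in> module.span scl (range f).
             1 / K * (norm \<alpha> * norm \<beta>) \<le> norm (seq_mult scl f \<alpha> \<beta>) \<and>
             norm (seq_mult scl f \<alpha> \<beta>) \<le> K * (norm \<alpha> * norm \<beta>)"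
  shows "equivalent_seqs scl norm e seq_scale c0_norm unit_vec \<or>
         (\<exists>p\<ge>1. equivalent_seqs scl norm e seq_scale (lp_norm p) unit_vec)"
proof -
  interpret scaled_norm scl
    using assms(1,2) by (simp add: scaled_norm_def scaled_norm_axioms_def)
  note inj = basic_sequence_independent(1)[OF assms(1,3)]
  note ind = basic_sequence_independent(2)[OF assms(1,3)]
  interpret tensor_seq scl e
  proof
    show "e 0 \<noteq> e 1" using inj by (simp add: inj_eq)
    have "(INF i. norm (e i)) \<le> norm (e i)" for i
      by (intro cINF_lower bdd_belowI[where m = 0]) auto
    then show "\<exists>c>0. \<forall>i. c \<le> norm (e i)"
      using assms(4) by (auto simp: semi_normalized_def)
    show "\<exists>B. \<forall>i. norm (e i) \<le> B"
      using assms(4) by (auto simp: semi_normalized_def bdd_above_def)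
    fix r :: "nat \<Rightarrow> nat" assume r: "strict_mono r"
    obtain K where K: "0 < K" "\<And>\<alpha> \<beta>. \<alpha> \<in> span (range (e \<circ> r)) \<Longrightarrow> \<beta> \<in> span (range (e \<circ> r)) \<Longrightarrow>
        1 / K * (norm \<alpha> * norm \<beta>) \<le> norm (seq_mult scl (e \<circ> r) \<alpha> \<beta>) \<and>
        norm (seq_mult scl (e \<circ> r) \<alpha> \<beta>) \<le> K * (norm \<alpha> * norm \<beta>)"
      using assms(5)[OF r refl] by blast
    have "comparable (max 1 K) (nrm (e \<circ> r) (n * m) (tensor m a b)) (nrm (e \<circ> r) n a * nrm (e \<circ> r) m b)"
      if "0 < m" for n m a b
    proof (rule tensor_comparable_if_seq_mult[OF _ _ _ that])
      show "inj (e \<circ> r)" using inj strict_mono_imp_inj_on[OF r] by (simp add: inj_compose)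
      show "independent (range (e \<circ> r))" by (rule independent_mono[OF ind]) auto
      fix \<alpha> \<beta> assume "\<alpha> \<in> span (range (e \<circ> r))" "\<beta> \<in> span (range (e \<circ> r))"
      then have "comparable K (norm (seq_mult scl (e \<circ> r) \<alpha> \<beta>)) (norm \<alpha> * norm \<beta>)"
        using K by (simp add: comparable_def field_simps)
      then show "comparable (max 1 K) (norm (seq_mult scl (e \<circ> r) \<alpha> \<beta>)) (norm \<alpha> * norm \<beta>)"
        by (rule comparable_mono) auto
    qed
    then show "\<exists>K\<ge>1. \<forall>n m a b. 0 < m \<longrightarrow>
        comparable K (nrm (\<lambda>i. e (r i)) (n * m) (tensor m a b))
          (nrm (\<lambda>i. e (r i)) n a * nrm (\<lambda>i. e (r i)) m b)"
      unfolding comp_def by (meson max.cobounded1)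
  qed
  obtain \<theta> C where \<theta>: "0 \<le> \<theta>" "\<theta> \<le> 1" and C: "1 \<le> C"
    and char: "\<And>n A. A \<subseteq> {..<n} \<Longrightarrow> A \<noteq> {} \<Longrightarrow>
      comparable C (nrm e n (char_seq A)) (real (card A) powr \<theta>)"
    by (rule growth) (rule that)
  show ?thesis
  proof (cases "\<theta> = 0")
    case True
    \<comment> \<open>For nonempty \<open>A\<close> the value \<open>real (card A) powr 0\<close> is
      1.\<close>
    have "nrm e n (char_seq A) \<le> C" if "A \<subseteq> {..<n}" "A \<noteq> {}" for n A
      using char[OF that] C True by (auto simp: comparable_def split: if_splits)
    then obtain M where "1 \<le> M" "\<And>n a. (\<And>i. n \<le> i \<Longrightarrow> a i = 0) \<Longrightarrow> comparable M (nrm e n a) (c0_norm a)"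
      using c0_comparable[OF C] by metis
    then show ?thesis using equivalent_unit_vec_if_comparable by blast
  next
    case False
    then have \<theta>0: "0 < \<theta>" using \<theta> by simp
    obtain K where K: "1 \<le> K"
      "\<And>n a. comparable K (nrm e n a) ((\<Sum>i<n. norm (a i) powr (1 / \<theta>)) powr \<theta>)"
      using lp_comparable[OF \<theta>0 \<theta>(2) C char] by blast
    have "comparable K (nrm e n a) (lp_norm (1 / \<theta>) a)" if "\<And>i. n \<le> i \<Longrightarrow> a i = 0" for n a
    proof -
      have "(\<Sum>i. norm (a i) powr (1 / \<theta>)) = (\<Sum>i<n. norm (a i) powr (1 / \<theta>))"
        using that by (intro suminf_finite) auto
      then show ?thesis using K(2)[of n a] by (simp add: lp_norm_def)
    qed
    then have "equivalent_seqs scl norm e seq_scale (lp_norm (1 / \<theta>)) unit_vec"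
      using equivalent_unit_vec_if_comparable[OF K(1)] by blast
    moreover have "1 \<le> 1 / \<theta>" using \<theta>0 \<theta>(2) by simp
    ultimately show ?thesis by blast
  qed
qed

end
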